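(* For real $x \geqslant 3$ let $$S(x)=\sum_{n \leqslant x} \varphi\left(\left\lfloor x/n \right\rfloor\right),$$ where $\varphi$ is the Euler totient function and $\lfloor \cdot \rfloor$ the integer part. Then, uniformly for all $x \geqslant 3$, $$\left(\frac{2629}{4009}\cdot\frac1{\zeta(2)} + \frac{1380}{4009}+o(1)\right) x\log x \;\geqslant\; S(x) \;\geqslant\; \left( \frac{2629}{4009} \cdot\frac1{\zeta(2)} + o(1) \right) x \log x,$$ where each $o(1)$ denotes a quantity tending to $0$ as $x \to \infty$.
   Context: $\zeta$ denotes the Riemann zeta function, so $\zeta(2)=\pi^2/6$. *)

theory Defs
  imports "HOL-Analysis.Analysis" "HOL-Number_Theory.Number_Theory"
begin

text \<open>The Riemann zeta function on the real half-line \<open>s > 1\<close>, by its Dirichlet series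
  (the sum starts at \<open>1\<close>, hence \<open>Suc n\<close>). For \<open>s \<le> 1\<close> the series diverges and the value is
  meaningless.\<close>

definition riemann_zeta :: "real \<Rightarrow> real" where
  "riemann_zeta s = (\<Sum>n. 1 / real (Suc n) powr s)"

definition S :: "real \<Rightarrow> nat" where
  "S x = (\<Sum>n | 1 \<le> n \<and> real n \<le> x. totient (nat \<lfloor>x / real n\<rfloor>))"

end

theory Submission
  imports Defs "HOL-Computational_Algebra.Squarefree" "HOL-Real_Asymp.Real_Asymp"
begin

text \<open>
  Group the \<open>n > sqrt x\<close> according to the value \<open>v = \<lfloor>x/n\<rfloor>\<close>: they contribute
  \<open>x * (\<Sum>v \<le> sqrt x. \<phi> v / (v (v+1))) + O(x)\<close>, that is \<open>1/2 * x * ln x / \<zeta>(2)\<close> asymptotically.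
  For \<open>n\<close> between \<open>x^0.34\<close> and \<open>x^0.499\<close>, write \<open>\<phi> v / v = (\<Sum>d dvd v. \<mu> d / d)\<close> and truncate at a small
  power of \<open>x\<close>. Then \<open>\<phi> v / v\<close> has mean \<open>1/\<zeta>(2)\<close> as soon as \<open>\<lfloor>x/n\<rfloor>\<close> is divisible by \<open>d\<close> with the
  expected frequency \<open>1/d\<close>, with a power saving and uniformly in \<open>d\<close>. Such a statement needs only
  Vinogradov's elementary second derivative method, which is effective for \<open>n > x^(1/3 + \<epsilon>)\<close>: near \<open>a\<close>
  the function \<open>x/(d n)\<close> is almost linear, its slope is close to a fraction \<open>u/q\<close> by Dirichlet's
  theorem, and \<open>q\<close> consecutive values then run almost through a coset of the \<open>q\<close>-th parts of the circle.

  For the remaining \<open>n\<close> the trivial bounds \<open>0 \<le> \<phi> v \<le> v\<close> suffice, since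
  \<open>1 - 0.34 - 0.001 = 0.659\<close> exceeds \<open>2629/4009 = 0.6557...\<close> and \<open>1/\<zeta>(2) \<le> 4/5\<close>. In fact both error functions
  vanish for large \<open>x\<close>.
\<close>

section \<open>The Moebius function and averages of the totient\<close>

definition moebius_mu :: "nat \<Rightarrow> real" where
  "moebius_mu d = (if squarefree d then (-1) ^ card (prime_factors d) else 0)"

lemma abs_moebius_mu_le: "\<bar>moebius_mu d\<bar> \<le> 1"
  by (simp add: moebius_mu_def)

lemma prime_factors_prod_primes:
  fixes A :: "nat set"
  assumes "finite A" "\<And>p. p \<in> A \<Longrightarrow> prime p"
  shows "prime_factors (\<Prod>A) = A"
proof -
  have "prime_factorization (\<Prod>A) = (\<Sum>p\<in>A. prime_factorization p)"
    using assms by (intro prime_factorization_prod) (auto simp: prime_gt_0_nat)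
  also have "\<dots> = (\<Sum>p\<in>A. {#p#})"
    using assms by (intro sum.cong refl prime_factorization_prime) auto
  also have "set_mset \<dots> = A"
    using assms(1) by (simp add: set_mset_sum)
  finally show ?thesis .
qed

lemma squarefree_prod_primes:
  fixes A :: "nat set"
  assumes "finite A" "\<And>p. p \<in> A \<Longrightarrow> prime p"
  shows "squarefree (\<Prod>A)"
  using assms by (intro squarefree_prod_coprime) (auto intro: primes_coprime squarefree_prime)

text \<open>A squarefree number is the product of its set of primes, so \<open>prime_factors\<close>
  inverts \<open>\<Prod>\<close>. This turns divisor sums weighted by the Moebius function into sums
  over subsets.\<close>

lemma bij_betw_squarefree_divisors:
  fixes n :: nat
  assumes "n > 0"
  shows "bij_betw \<Prod> (Pow (prime_factors n)) {d. d dvd n \<and> squarefree d}"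
proof (rule bij_betwI[where g = prime_factors])
  show "\<Prod> \<in> Pow (prime_factors n) \<rightarrow> {d. d dvd n \<and> squarefree d}"
  proof safe
    fix A assume A: "A \<subseteq> prime_factors n"
    have fin: "finite A" using A finite_subset by blast
    have "\<Prod>A dvd \<Prod>(prime_factors n)"
      using A by (intro prod_dvd_prod_subset) auto
    also have "\<dots> dvd (\<Prod>p\<in>prime_factors n. p ^ multiplicity p n)"
      by (intro prod_dvd_prod) (auto simp: prime_factors_multiplicity intro!: dvd_power)
    also have "\<dots> = n"
      using assms by (simp add: prod_prime_factors)
    finally show "\<Prod>A dvd n" .
    show "squarefree (\<Prod>A)" using A fin by (intro squarefree_prod_primes) auto
  qed
  show "prime_factors \<in> {d. d dvd n \<and> squarefree d} \<rightarrow> Pow (prime_factors n)"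
    using assms by (auto dest: dvd_prime_factors[of n, rotated] simp del: in_prime_factors_iff)
  show "prime_factors (\<Prod>A) = A" if "A \<in> Pow (prime_factors n)" for A
    using that by (intro prime_factors_prod_primes) (auto intro: finite_subset)
  show "\<Prod>(prime_factors d) = d" if "d \<in> {d. d dvd n \<and> squarefree d}" for d
  proof -
    have d: "d > 0" "squarefree d" using that assms by (auto intro: Nat.gr0I)
    have "d = (\<Prod>p\<in>prime_factors d. p ^ multiplicity p d)"
      using d by (simp add: prod_prime_factors)
    also have "\<dots> = \<Prod>(prime_factors d)"
      using d by (intro prod.cong refl) (auto simp: squarefree_factorial_semiring'' prime_factors_multiplicity le_Suc_eq)
    finally show ?thesis by simp
  qed
qed

lemma card_squarefree_divisors:
  fixes n :: nat
  assumes "n > 0"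
  shows "card {d. d dvd n \<and> squarefree d} = 2 ^ card (prime_factors n)"
  using bij_betw_same_card[OF bij_betw_squarefree_divisors[OF assms]]
  by (simp add: card_Pow)

text \<open>Only squarefree divisors contribute, and summing over the subsets of the prime factors
  is what expanding the Euler product gives. The exponent stays general because \<open>s = 1\<close>
  yields the totient and \<open>s = 0\<close> the Moebius sum, where every factor vanishes.\<close>

lemma sum_moebius_mu_divisors:
  assumes "n > 0"
  shows "(\<Sum>d | d dvd n. moebius_mu d / real d ^ s) = (\<Prod>p\<in>prime_factors n. 1 - 1 / real p ^ s)"
proof -
  have "(\<Sum>d | d dvd n. moebius_mu d / real d ^ s)
      = (\<Sum>d | d dvd n \<and> squarefree d. moebius_mu d / real d ^ s)"
    using assms by (intro sum.mono_neutral_right) (auto simp: moebius_mu_def)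
  also have "\<dots> = (\<Sum>A\<in>Pow (prime_factors n). moebius_mu (\<Prod>A) / real (\<Prod>A) ^ s)"
    by (intro sum.reindex_bij_betw[symmetric] bij_betw_squarefree_divisors assms)
  also have "\<dots> = (\<Sum>A\<in>Pow (prime_factors n). (-1) ^ card A * (\<Prod>p\<in>A. 1 / real p ^ s) * (\<Prod>p\<in>prime_factors n - A. 1))"
  proof (intro sum.cong refl)
    fix A assume "A \<in> Pow (prime_factors n)"
    hence "finite A" "\<And>p. p \<in> A \<Longrightarrow> prime p" by (auto intro: finite_subset)
    thus "moebius_mu (\<Prod>A) / real (\<Prod>A) ^ s
        = (-1) ^ card A * (\<Prod>p\<in>A. 1 / real p ^ s) * (\<Prod>p\<in>prime_factors n - A. 1)"
      by (simp add: moebius_mu_def squarefree_prod_primes prime_factors_prod_primes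
          prod_dividef prod_power_distrib)
  qed
  also have "\<dots> = (\<Prod>p\<in>prime_factors n. 1 - 1 / real p ^ s)"
    by (subst prod_diff_conv_sum) auto
  finally show ?thesis .
qed

lemma totient_eq_sum_moebius_mu:
  assumes "n > 0"
  shows "real (totient n) = real n * (\<Sum>d | d dvd n. moebius_mu d / real d)"
  using sum_moebius_mu_divisors[OF assms, of 1] totient_formula2[of n] by simp

lemma sum_moebius_mu_eq:
  assumes "n > 0"
  shows "(\<Sum>d | d dvd n. moebius_mu d) = (if n = 1 then 1 else 0)"
proof -
  have "prime_factors n = {} \<longleftrightarrow> n = 1"
    using assms by (auto simp: prime_factorization_empty_iff)
  thus ?thesis
    using sum_moebius_mu_divisors[OF assms, of 0] by (auto simp: power_0_left)
qed

text \<open>There are at most \<open>b\<close> primes below \<open>b\<close>, and each larger prime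
  factor pays for its own factor \<open>b\<close>, since the product of distinct prime factors
  divides \<open>n\<close>. With \<open>b = 2^k\<close> this bounds the number of squarefree
  divisors by a constant times the \<open>k\<close>-th root of \<open>n\<close>.\<close>

lemma power_card_prime_factors_le:
  fixes b n :: nat
  assumes "n > 0" "b > 0"
  shows "b ^ card (prime_factors n) \<le> b ^ b * n"
proof -
  let ?A = "{p \<in> prime_factors n. p < b}" and ?B = "{p \<in> prime_factors n. \<not> p < b}"
  have "?A \<subseteq> {..<b}" by auto
  hence "card ?A \<le> b" using card_mono[of "{..<b}" ?A] by simp
  hence A: "b ^ card ?A \<le> b ^ b" using assms by (intro power_increasing) auto
  have "b ^ card ?B = (\<Prod>p\<in>?B. b)" by simp
  also have "\<dots> \<le> \<Prod>?B" by (intro prod_mono) auto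
  also have "\<dots> \<le> n"
  proof -
    have "\<Prod>?B \<in> {d. d dvd n \<and> squarefree d}"
      using bij_betw_apply[OF bij_betw_squarefree_divisors[OF assms(1)], of ?B] by auto
    thus ?thesis using assms by (auto intro: dvd_imp_le)
  qed
  finally have B: "b ^ card ?B \<le> n" .
  have "card (prime_factors n) = card (?A \<union> ?B)" by (rule arg_cong[of _ _ card]) auto
  also have "\<dots> = card ?A + card ?B" by (intro card_Un_disjoint) auto
  finally show ?thesis using A B by (simp only: power_add mult_le_mono)
qed

text \<open>Both sides run over the pairs \<open>(d, k)\<close> with \<open>d * k \<le> R\<close>,
  on the left collected by the product \<open>n = d * k\<close>.\<close>

lemma sum_divisors_hyperbola:
  fixes f :: "nat \<Rightarrow> nat \<Rightarrow> real"
  shows "(\<Sum>n=1..R. \<Sum>d | d dvd n. f d (n div d)) = (\<Sum>d=1..R. \<Sum>k=1..R div d. f d k)"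
proof -
  have le: "d \<le> R" if "d * k \<le> R" "k > 0" for d k :: nat
  proof -
    have "d * 1 \<le> d * k" using that by (intro mult_le_mono2) simp
    thus ?thesis using that by linarith
  qed
  have "(\<Sum>n=1..R. \<Sum>d | d dvd n. f d (n div d))
      = (\<Sum>(n, d)\<in>(SIGMA n:{1..R}. {d. d dvd n}). f d (n div d))"
    by (intro sum.Sigma) auto
  also have "(\<Sum>(n, d)\<in>(SIGMA n:{1..R}. {d. d dvd n}). f d (n div d))
      = (\<Sum>(d, k)\<in>(SIGMA d:{1..R}. {1..R div d}). f d k)"
    by (rule sum.reindex_bij_witness[of _ "\<lambda>(d, k). (d * k, d)" "\<lambda>(n, d). (d, n div d)"])
       (auto simp: less_eq_div_iff_mult_less_eq mult.commute Suc_le_eq dvd_imp_le div_le_mono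
          div_greater_zero_iff intro: Nat.gr0I le elim!: dvdE)
  also have "\<dots> = (\<Sum>d=1..R. \<Sum>k=1..R div d. f d k)"
    by (intro sum.Sigma[symmetric]) auto
  finally show ?thesis .
qed


section \<open>The value zeta(2) and the partial sums of mu(d) / d^2\<close>

lemma summable_inverse_square_Suc: "summable (\<lambda>n. 1 / real (Suc n) ^ 2)"
  using inverse_squares_sums by (simp add: sums_iff add.commute)

lemma riemann_zeta_2_sums: "(\<lambda>n. 1 / real (Suc n) ^ 2) sums riemann_zeta 2"
proof -
  have "(\<lambda>n. 1 / real (Suc n) powr 2) = (\<lambda>n. 1 / real (Suc n) ^ 2)"
    by (intro ext) simp
  thus ?thesis
    using summable_sums[OF summable_inverse_square_Suc] by (simp add: riemann_zeta_def)
qed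

lemma sum_inverse_square_le_zeta: "(\<Sum>k=1..m. 1 / real k ^ 2) \<le> riemann_zeta 2"
proof -
  have "(\<Sum>k=1..m. 1 / real k ^ 2) = (\<Sum>n<m. 1 / real (Suc n) ^ 2)"
    by (intro sum.reindex_bij_witness[of _ Suc "\<lambda>k. k - 1"]) auto
  also have "\<dots> \<le> riemann_zeta 2"
    using sum_le_suminf[OF summable_inverse_square_Suc, of "{..<m}"] riemann_zeta_2_sums
    by (simp add: sums_iff)
  finally show ?thesis .
qed

lemma riemann_zeta_2_ge: "riemann_zeta 2 \<ge> 5 / 4"
  using sum_inverse_square_le_zeta[of 2] by (simp add: numeral_2_eq_2)

lemma zeta_2_tail:
  assumes "m > 0"
  shows "\<bar>(\<Sum>k=1..m. 1 / real k ^ 2) - riemann_zeta 2\<bar> \<le> 1 / real m"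
proof -
  \<comment> \<open>Telescoping majorant: \<open>1 / (k+1)^2\<close> is at most
    \<open>1 / k - 1 / (k+1)\<close>.\<close>
  have bound: "(\<Sum>k=1..m+j. 1 / real k ^ 2) \<le> (\<Sum>k=1..m. 1 / real k ^ 2) + (1 / real m - 1 / real (m + j))" for j
  proof (induction j)
    case (Suc j)
    have "1 / real (m + Suc j) ^ 2 \<le> 1 / real (m + j) - 1 / real (m + Suc j)"
      using assms by (simp add: divide_simps power2_eq_square)
    thus ?case using Suc by simp
  qed simp
  have "riemann_zeta 2 \<le> (\<Sum>k=1..m. 1 / real k ^ 2) + 1 / real m"
  proof (rule LIMSEQ_le_const2)
    show "(\<lambda>n. \<Sum>k<n. 1 / real (Suc k) ^ 2) \<longlonglongrightarrow> riemann_zeta 2"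
      using riemann_zeta_2_sums by (simp add: sums_def)
    have "(\<Sum>k<n. 1 / real (Suc k) ^ 2) \<le> (\<Sum>k=1..m. 1 / real k ^ 2) + 1 / real m" if "n \<ge> m" for n
    proof -
      have "(\<Sum>k<n. 1 / real (Suc k) ^ 2) = (\<Sum>k=1..n. 1 / real k ^ 2)"
        by (intro sum.reindex_bij_witness[of _ "\<lambda>k. k - 1" Suc]) auto
      also have "\<dots> \<le> (\<Sum>k=1..m. 1 / real k ^ 2) + (1 / real m - 1 / real (m + (n - m)))"
        using bound[of "n - m"] that by simp
      also have "\<dots> \<le> (\<Sum>k=1..m. 1 / real k ^ 2) + 1 / real m" by simp
      finally show ?thesis .
    qed
    thus "\<exists>N. \<forall>n\<ge>N. (\<Sum>k<n. 1 / real (Suc k) ^ 2) \<le> (\<Sum>k=1..m. 1 / real k ^ 2) + 1 / real m"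
      by blast
  qed
  thus ?thesis using sum_inverse_square_le_zeta[of m] by simp
qed

lemma harm_le_ln: "n > 0 \<Longrightarrow> harm n \<le> 1 + ln (real n)"
  using euler_mascheroni_sequence_decreasing[of 1 n] by (simp add: harm_expand)

text \<open>The identity "the sum of mu over the divisors of n is 1 only for n = 1", weighted by
  \<open>1 / n^2\<close>, is regrouped by \<open>n = d * k\<close>. Completing each inner sum over
  \<open>k\<close> to zeta(2) costs \<open>O(d / R)\<close>, and after division by
  \<open>d^2\<close> these costs add up to a harmonic sum over \<open>R\<close>.\<close>

lemma sum_moebius_mu_squares_bound:
  assumes "R > 0"
  shows "\<bar>riemann_zeta 2 * (\<Sum>d=1..R. moebius_mu d / real d ^ 2) - 1\<bar> \<le> 2 * (1 + ln (real R)) / real R"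
proof -
  let ?Z = "riemann_zeta 2"
  have "1 = (\<Sum>n=1..R. (\<Sum>d | d dvd n. moebius_mu d) / real n ^ 2)"
  proof -
    have "(\<Sum>n=1..R. (\<Sum>d | d dvd n. moebius_mu d) / real n ^ 2) = (\<Sum>n=1..R. if n = 1 then 1 else 0)"
      by (intro sum.cong refl) (auto simp: sum_moebius_mu_eq)
    thus ?thesis using assms by simp
  qed
  also have "\<dots> = (\<Sum>n=1..R. \<Sum>d | d dvd n. moebius_mu d / (real d ^ 2 * real (n div d) ^ 2))"
    by (intro sum.cong refl)
       (auto simp: sum_divide_distrib power_mult_distrib elim!: dvdE intro!: sum.cong)
  also have "\<dots> = (\<Sum>d=1..R. \<Sum>k=1..R div d. moebius_mu d / (real d ^ 2 * real k ^ 2))"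
    by (rule sum_divisors_hyperbola)
  also have "\<dots> = (\<Sum>d=1..R. moebius_mu d / real d ^ 2 * (\<Sum>k=1..R div d. 1 / real k ^ 2))"
    by (simp add: sum_distrib_left)
  finally have "\<bar>?Z * (\<Sum>d=1..R. moebius_mu d / real d ^ 2) - 1\<bar>
      = \<bar>(\<Sum>d=1..R. moebius_mu d / real d ^ 2 * ((\<Sum>k=1..R div d. 1 / real k ^ 2) - ?Z))\<bar>"
    by (simp add: sum_distrib_left sum_subtractf right_diff_distrib mult.commute)
  also have "\<dots> \<le> (\<Sum>d=1..R. 2 / real R * (1 / real d))"
  proof (intro order_trans[OF sum_abs] sum_mono)
    fix d assume d: "d \<in> {1..R}"
    have pos: "R div d > 0" using d by (simp add: div_greater_zero_iff)
    \<comment> \<open>As \<open>R div d\<close> is at least 1, rounding down loses at most a factor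
      2.\<close>
    have "real R \<le> 2 * real d * real (R div d)"
    proof -
      have "R = d * (R div d) + R mod d" by simp
      also have "\<dots> \<le> d * (R div d) + d * (R div d)"
      proof (rule add_left_mono)
        have "R mod d < d" using d by simp
        also have "d \<le> d * (R div d)" using pos by simp
        finally show "R mod d \<le> d * (R div d)" by simp
      qed
      finally show ?thesis by (metis mult.assoc mult_2 of_nat_le_iff of_nat_mult of_nat_numeral)
    qed
    hence "1 / real (R div d) \<le> 2 * real d / real R"
      using pos assms d by (simp add: field_simps)
    hence "\<bar>(\<Sum>k=1..R div d. 1 / real k ^ 2) - ?Z\<bar> \<le> 2 * real d / real R"
      using zeta_2_tail[OF pos] by linarith
    hence "\<bar>moebius_mu d\<bar> * \<bar>(\<Sum>k=1..R div d. 1 / real k ^ 2) - ?Z\<bar> \<le> 1 * (2 * real d / real R)"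
      by (intro mult_mono abs_moebius_mu_le) auto
    hence "\<bar>moebius_mu d\<bar> * \<bar>(\<Sum>k=1..R div d. 1 / real k ^ 2) - ?Z\<bar> / real d ^ 2 \<le> 1 * (2 * real d / real R) / real d ^ 2"
      by (intro divide_right_mono) auto
    also have "\<dots> = 2 / real R * (1 / real d)"
      using d by (simp add: power2_eq_square)
    finally show "\<bar>moebius_mu d / real d ^ 2 * ((\<Sum>k=1..R div d. 1 / real k ^ 2) - ?Z)\<bar> \<le> 2 / real R * (1 / real d)"
      by (simp add: abs_mult)
  qed
  also have "\<dots> = 2 / real R * harm R"
    by (simp add: harm_def sum_distrib_left divide_inverse)
  also have "\<dots> \<le> 2 / real R * (1 + ln (real R))"
    using assms by (intro mult_left_mono harm_le_ln) auto
  finally show ?thesis by simp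
qed

lemma sum_moebius_mu_squares_tendsto:
  "(\<lambda>R. \<Sum>d=1..R. moebius_mu d / real d ^ 2) \<longlonglongrightarrow> 1 / riemann_zeta 2"
proof -
  let ?M = "\<lambda>R. \<Sum>d=1..R. moebius_mu d / real d ^ 2"
  have "(\<lambda>R. riemann_zeta 2 * ?M R - 1) \<longlonglongrightarrow> 0"
  proof (rule Lim_null_comparison)
    show "\<forall>\<^sub>F R in sequentially. norm (riemann_zeta 2 * ?M R - 1) \<le> 2 * (1 + ln (real R)) / real R"
      using eventually_gt_at_top[of 0]
    proof eventually_elim
      case (elim R)
      thus ?case using sum_moebius_mu_squares_bound[of R] by simp
    qed
    show "(\<lambda>R. 2 * (1 + ln (real R)) / real R) \<longlonglongrightarrow> 0" by real_asymp
  qed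
  hence "(\<lambda>R. (1 + (riemann_zeta 2 * ?M R - 1)) / riemann_zeta 2) \<longlonglongrightarrow> (1 + 0) / riemann_zeta 2"
    using riemann_zeta_2_ge by (intro tendsto_intros) auto
  thus ?thesis using riemann_zeta_2_ge by simp
qed

section \<open>Logarithmic averages of the totient\<close>

lemma sum_totient_squares_bound:
  "\<exists>C. \<forall>R>0. \<bar>(\<Sum>v=1..R. real (totient v) / real v ^ 2)
      - ln (real R) * (\<Sum>d=1..R. moebius_mu d / real d ^ 2)\<bar> \<le> C"
proof -
  \<comment> \<open>The majorant of \<open>(1 + ln d) / d^2\<close>, the cost of replacing the
    harmonic sum up to \<open>R div d\<close> by \<open>ln R\<close>; it comes from
    \<open>ln d \<le> 2 * sqrt d - 2\<close>. The term \<open>d = 0\<close> vanishes.\<close>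
  have summ: "summable (\<lambda>d. 2 * real d powr (-(3/2)))"
    by (intro summable_mult) (simp add: summable_real_powr_iff)
  define C where "C = (\<Sum>d. 2 * real d powr (-(3/2)))"
  have "\<bar>(\<Sum>v=1..R. real (totient v) / real v ^ 2)
      - ln (real R) * (\<Sum>d=1..R. moebius_mu d / real d ^ 2)\<bar> \<le> C" if R: "R > 0" for R
  proof -
    have "(\<Sum>v=1..R. real (totient v) / real v ^ 2)
        = (\<Sum>v=1..R. \<Sum>d | d dvd v. moebius_mu d / (real d ^ 2 * real (v div d)))"
    proof (intro sum.cong refl)
      fix v assume v: "v \<in> {1..R}"
      have "real (totient v) / real v ^ 2 = (\<Sum>d | d dvd v. moebius_mu d / real d / real v)"
        using totient_eq_sum_moebius_mu[of v] v by (simp add: power2_eq_square sum_divide_distrib)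
      also have "\<dots> = (\<Sum>d | d dvd v. moebius_mu d / (real d ^ 2 * real (v div d)))"
        using v by (intro sum.cong refl) (auto simp: power2_eq_square elim!: dvdE)
      finally show "real (totient v) / real v ^ 2
          = (\<Sum>d | d dvd v. moebius_mu d / (real d ^ 2 * real (v div d)))" .
    qed
    also have "\<dots> = (\<Sum>d=1..R. \<Sum>k=1..R div d. moebius_mu d / (real d ^ 2 * real k))"
      by (rule sum_divisors_hyperbola)
    also have "\<dots> = (\<Sum>d=1..R. moebius_mu d / real d ^ 2 * harm (R div d))"
      by (simp add: sum_distrib_left harm_def divide_inverse mult_ac)
    finally have "\<bar>(\<Sum>v=1..R. real (totient v) / real v ^ 2)
        - ln (real R) * (\<Sum>d=1..R. moebius_mu d / real d ^ 2)\<bar>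
      = \<bar>\<Sum>d=1..R. moebius_mu d / real d ^ 2 * (harm (R div d) - ln (real R))\<bar>"
      by (simp add: sum_distrib_left sum_subtractf right_diff_distrib diff_divide_distrib mult.commute)
    also have "\<dots> \<le> (\<Sum>d=1..R. 2 * real d powr (-(3/2)))"
    proof (intro order_trans[OF sum_abs] sum_mono)
      fix d assume d: "d \<in> {1..R}"
      have pos: "R div d > 0" using d by (simp add: div_greater_zero_iff)
      have le: "real (R div d) \<le> real R / real d" by (rule of_nat_div_le_of_nat)
      have "real R / real d \<le> real (R div d) + 1"
        using d by (metis floor_divide_of_nat_eq of_int_of_nat_eq real_of_int_floor_add_one_ge)
      hence "ln (real R / real d) \<le> ln (real (R div d) + 1)"
        using d by (subst ln_le_cancel_iff) auto
      hence "ln (real R) - ln (real d) \<le> harm (R div d)"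
        using harm_ge_ln[of "R div d"] d by (simp add: ln_div)
      moreover have "ln (real (R div d)) \<le> ln (real R / real d)"
        using le pos d by (subst ln_le_cancel_iff) auto
      hence "harm (R div d) \<le> 1 + ln (real R) - ln (real d)"
        using harm_le_ln[OF pos] d by (simp add: ln_div)
      moreover have lnd: "ln (real d) \<ge> 0" using d by simp
      ultimately have "\<bar>harm (R div d) - ln (real R)\<bar> \<le> 1 + ln (real d)" by linarith
      also have "\<dots> \<le> 2 * sqrt (real d)"
      proof -
        have "ln (sqrt (real d)) \<le> sqrt (real d) - 1" using d by (intro ln_le_minus_one) auto
        hence "ln (real d) \<le> 2 * sqrt (real d) - 2" using d by (simp add: ln_sqrt)
        thus ?thesis by simp
      qed
      finally have "\<bar>moebius_mu d\<bar> * \<bar>harm (R div d) - ln (real R)\<bar> \<le> 1 * (2 * sqrt (real d))"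
        by (intro mult_mono abs_moebius_mu_le) auto
      hence "\<bar>moebius_mu d\<bar> * \<bar>harm (R div d) - ln (real R)\<bar> / real d ^ 2 \<le> 2 * (sqrt (real d) / real d ^ 2)"
        by (simp add: divide_right_mono)
      also have "sqrt (real d) / real d ^ 2 = real d powr (1/2) / real d powr 2"
        using d by (simp add: powr_half_sqrt)
      also have "\<dots> = real d powr (1/2 - 2)" by (rule powr_diff[symmetric])
      also have "1/2 - 2 = (-(3/2) :: real)" by simp
      finally show "\<bar>moebius_mu d / real d ^ 2 * (harm (R div d) - ln (real R))\<bar> \<le> 2 * real d powr (-(3/2))"
        by (simp add: abs_mult)
    qed
    also have "\<dots> \<le> C" unfolding C_def by (rule sum_le_suminf[OF summ]) auto
    finally show ?thesis .
  qed
  thus ?thesis by blast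
qed

text \<open>The weight \<open>1 / (v * (v+1)) = 1 / v - 1 / (v+1)\<close> is the approximate
  proportion, relative to \<open>x\<close>, of the \<open>n\<close> with
  \<open>\<lfloor>x/n\<rfloor> = v\<close>. Passing to it from \<open>1 / v^2\<close> changes the
  \<open>v\<close>-th term by at most \<open>1 / v^2\<close>, hence the sum by a bounded
  amount.\<close>

lemma sum_totient_values_bound:
  "\<exists>C. \<forall>R>0. \<bar>(\<Sum>v=1..R. real (totient v) / (real v * real (v + 1)))
      - ln (real R) * (\<Sum>d=1..R. moebius_mu d / real d ^ 2)\<bar> \<le> C"
proof -
  obtain C where C: "\<And>R. R > 0 \<Longrightarrow> \<bar>(\<Sum>v=1..R. real (totient v) / real v ^ 2)
      - ln (real R) * (\<Sum>d=1..R. moebius_mu d / real d ^ 2)\<bar> \<le> C"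
    using sum_totient_squares_bound by blast
  have "\<bar>(\<Sum>v=1..R. real (totient v) / (real v * real (v + 1)))
      - ln (real R) * (\<Sum>d=1..R. moebius_mu d / real d ^ 2)\<bar> \<le> C + riemann_zeta 2" if "R > 0" for R
  proof -
    have "\<bar>(\<Sum>v=1..R. real (totient v) / real v ^ 2) - (\<Sum>v=1..R. real (totient v) / (real v * real (v + 1)))\<bar>
       \<le> (\<Sum>v=1..R. 1 / real v ^ 2)"
      unfolding sum_subtractf[symmetric]
    proof (intro order_trans[OF sum_abs] sum_mono)
      fix v assume v: "v \<in> {1..R}"
      have "real (totient v) / real v ^ 2 - real (totient v) / (real v * real (v + 1))
          = real (totient v) / real (v + 1) * (1 / real v ^ 2)"
        using v by (simp add: divide_simps power2_eq_square) (simp add: algebra_simps)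
      moreover have "real (totient v) / real (v + 1) \<le> 1"
        using totient_le[of v] by simp
      hence "real (totient v) / real (v + 1) * (1 / real v ^ 2) \<le> 1 * (1 / real v ^ 2)"
        by (intro mult_right_mono) auto
      moreover have "real (totient v) / real (v + 1) * (1 / real v ^ 2) \<ge> 0" by simp
      ultimately show "\<bar>real (totient v) / real v ^ 2 - real (totient v) / (real v * real (v + 1))\<bar> \<le> 1 / real v ^ 2"
        by linarith
    qed
    also have "\<dots> \<le> riemann_zeta 2" by (rule sum_inverse_square_le_zeta)
    finally show ?thesis using C[OF that] by linarith
  qed
  thus ?thesis by blast
qed

section \<open>Equidistribution of a hyperbola modulo one\<close>

lemma sum_lessThan_nat: "(\<Sum>j<q. real j) = real q * (real q - 1) / 2"
  by (induction q) (auto simp: field_simps)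

text \<open>As \<open>u * h\<close> runs through a complete residue system modulo \<open>q\<close>,
  the fractional parts are \<open>(j + \<theta>) / q\<close> for \<open>j < q\<close>, with one
  common \<open>\<theta>\<close> in \<open>[0, 1)\<close>. The sum is therefore exactly
  \<open>\<theta> - 1/2\<close>, whatever the size of \<open>q\<close>.\<close>

lemma sum_frac_arith_progression:
  fixes t :: real and u :: int
  assumes "q > 0" "coprime u (int q)"
  shows "\<bar>\<Sum>h<q. frac (t + of_int u * real h / real q) - 1 / 2\<bar> \<le> 1 / 2"
proof -
  define m where "m = \<lfloor>real q * t\<rfloor>"
  define \<theta> where "\<theta> = frac (real q * t)"
  have \<theta>: "0 \<le> \<theta>" "\<theta> < 1" unfolding \<theta>_def by (auto intro: frac_lt_1)
  have qt: "real q * t = of_int m + \<theta>" by (simp add: m_def \<theta>_def frac_def)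
  define r where "r h = nat ((m + u * int h) mod int q)" for h
  have frac_eq: "frac (t + of_int u * real h / real q) = (real (r h) + \<theta>) / real q" for h
  proof (rule frac_unique_iff[THEN iffD2], intro conjI)
    let ?z = "m + u * int h"
    have r_eq: "real (r h) = of_int (?z mod int q)"
      using assms by (simp add: r_def)
    have "t + of_int u * real h / real q = (of_int ?z + \<theta>) / real q"
      using qt assms by (simp add: field_simps)
    also have "?z = int q * (?z div int q) + ?z mod int q" by simp
    finally have "t + of_int u * real h / real q
        = (of_int (int q * (?z div int q) + ?z mod int q) + \<theta>) / real q" .
    also have "\<dots> = of_int (?z div int q) + (real (r h) + \<theta>) / real q"
      using assms unfolding r_eq of_int_add of_int_mult by (simp add: field_simps)
    finally show "t + of_int u * real h / real q - (real (r h) + \<theta>) / real q \<in> \<int>" by simp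
    show "0 \<le> (real (r h) + \<theta>) / real q" using \<theta> by simp
    have "?z mod int q < int q" using assms by (intro pos_mod_bound) auto
    hence "r h < q" using assms unfolding r_def by (simp add: nat_less_iff)
    hence "real (r h) + 1 \<le> real q" by linarith
    thus "(real (r h) + \<theta>) / real q < 1" using \<theta> assms by simp
  qed
  have inj: "inj_on r {..<q}"
  proof (rule inj_onI)
    fix h k assume hk: "h \<in> {..<q}" "k \<in> {..<q}" "r h = r k"
    hence "[m + u * int h = m + u * int k] (mod int q)"
      using assms by (auto simp: r_def cong_def nat_eq_iff)
    hence "[u * int h = u * int k] (mod int q)" by (simp add: cong_add_lcancel)
    hence "[int h = int k] (mod int q)" using assms by (simp add: cong_mult_lcancel)
    thus "h = k" using hk by (auto simp: cong_def)
  qed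
  have "r ` {..<q} \<subseteq> {..<q}"
  proof safe
    fix h
    have "(m + u * int h) mod int q < int q" using assms by (intro pos_mod_bound) auto
    thus "r h < q" using assms unfolding r_def by (simp add: nat_less_iff)
  qed
  hence bij: "bij_betw r {..<q} {..<q}"
    using inj by (simp add: bij_betw_def endo_inj_surj)
  have "(\<Sum>h<q. frac (t + of_int u * real h / real q) - 1 / 2) = (\<Sum>h<q. (real (r h) + \<theta>) / real q - 1 / 2)"
    by (simp add: frac_eq)
  also have "\<dots> = (\<Sum>j<q. (real j + \<theta>) / real q - 1 / 2)"
    by (rule sum.reindex_bij_betw[OF bij])
  also have "\<dots> = ((\<Sum>j<q. real j) + real q * \<theta>) / real q - real q / 2"
    by (simp add: sum_subtractf sum.distrib flip: sum_divide_distrib)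
  also have "\<dots> = \<theta> - 1 / 2"
    using assms by (simp add: sum_lessThan_nat field_simps)
  finally show ?thesis using \<theta> by (simp add: abs_if)
qed

text \<open>\<open>frac\<close> jumps at integers, so \<open>frac a\<close> and
  \<open>frac b\<close> may be far apart. Moving the comparison point by \<open>\<eta>\<close>
  orders the floors, and no case distinction about a crossed integer is left.\<close>

lemma frac_perturb:
  fixes a b \<eta> :: real
  assumes "\<bar>a - b\<bar> \<le> \<eta>"
  shows "frac a \<le> frac (b - \<eta>) + 2 * \<eta>" "frac a \<ge> frac (b + \<eta>) - 2 * \<eta>"
proof -
  have "\<lfloor>b - \<eta>\<rfloor> \<le> \<lfloor>a\<rfloor>" "\<lfloor>a\<rfloor> \<le> \<lfloor>b + \<eta>\<rfloor>" using assms by (auto intro!: floor_mono)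
  thus "frac a \<le> frac (b - \<eta>) + 2 * \<eta>" "frac a \<ge> frac (b + \<eta>) - 2 * \<eta>"
    using assms unfolding frac_def by linarith+
qed

text \<open>Shifting \<open>t\<close> by \<open>\<eta>\<close> in either direction leaves an
  arithmetic progression with the same step, so each side of the estimate reduces to the exact
  progression.\<close>

lemma sum_frac_near_arith_progression:
  fixes t \<eta> :: real and u :: int
  assumes "q > 0" "coprime u (int q)"
  assumes near: "\<And>h. h < q \<Longrightarrow> \<bar>f h - (t + of_int u * real h / real q)\<bar> \<le> \<eta>"
  shows "\<bar>\<Sum>h<q. frac (f h) - 1 / 2\<bar> \<le> 1 + 2 * \<eta> * real q"
proof -
  let ?s = "\<lambda>t h. t + of_int u * real h / real q"
  have "(\<Sum>h<q. frac (f h) - 1 / 2) \<le> (\<Sum>h<q. frac (?s (t - \<eta>) h) - 1 / 2 + 2 * \<eta>)"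
    using frac_perturb(1)[OF near] by (intro sum_mono) (auto simp: algebra_simps)
  also have "\<dots> = (\<Sum>h<q. frac (?s (t - \<eta>) h) - 1 / 2) + 2 * \<eta> * real q"
    by (simp add: sum.distrib)
  also have "\<dots> \<le> 1 + 2 * \<eta> * real q"
    using sum_frac_arith_progression[OF assms(1,2), of "t - \<eta>"] by simp
  finally have upper: "(\<Sum>h<q. frac (f h) - 1 / 2) \<le> 1 + 2 * \<eta> * real q" .
  have "- 1 - 2 * \<eta> * real q \<le> (\<Sum>h<q. frac (?s (t + \<eta>) h) - 1 / 2) - 2 * \<eta> * real q"
    using sum_frac_arith_progression[OF assms(1,2), of "t + \<eta>"] by simp
  also have "\<dots> = (\<Sum>h<q. frac (?s (t + \<eta>) h) - 1 / 2 - 2 * \<eta>)"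
    by (simp add: sum_subtractf)
  also have "\<dots> \<le> (\<Sum>h<q. frac (f h) - 1 / 2)"
    using frac_perturb(2)[OF near] by (intro sum_mono) (auto simp: algebra_simps)
  finally show ?thesis using upper by linarith
qed

text \<open>
  Walk through the interval in blocks \<open>[a, a + Q a)\<close>. The error \<open>1\<close> of a block is spread over its
  \<open>Q a > K\<close> elements, or charged to its starting point if \<open>Q a \<le> K\<close>.
\<close>
lemma sum_greedy_blocks:
  fixes G :: "nat \<Rightarrow> real" and Q :: "nat \<Rightarrow> nat"
  assumes G: "\<And>n. \<bar>G n\<bar> \<le> 1" and \<eta>: "\<eta> \<ge> 0" and K: "K > 0"
  assumes Q: "\<And>a. 0 < Q a" "\<And>a. Q a \<le> T"
  assumes block: "\<And>a. N \<le> a \<Longrightarrow> a + Q a \<le> b \<Longrightarrow> \<bar>\<Sum>n=a..<a+Q a. G n\<bar> \<le> 1 + \<eta> * real (Q a)"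
  assumes "N \<le> a" "a \<le> b"
  shows "\<bar>\<Sum>n=a..<b. G n\<bar> \<le> (\<eta> + 1 / real K) * real (b - a) + real (card {n\<in>{a..<b}. Q n \<le> K}) + real T"
  using assms(7,8)
proof (induction "b - a" arbitrary: a rule: less_induct)
  case less
  let ?bad = "\<lambda>a b. {n\<in>{a..<b}. Q n \<le> K}"
  show ?case
  proof (cases "a + Q a \<le> b")
    case False
    \<comment> \<open>The interval ends inside the block starting at \<open>a\<close>, so fewer than
      \<open>Q a \<le> T\<close> terms remain and the trivial bound applies.\<close>
    have "\<bar>\<Sum>n=a..<b. G n\<bar> \<le> (\<Sum>n=a..<b. 1)"
      by (intro order_trans[OF sum_abs] sum_mono G)
    also have "\<dots> \<le> real T" using False Q(2)[of a] by simp
    finally show ?thesis using \<eta> by (smt (verit) mult_nonneg_nonneg of_nat_0_le_iff divide_nonneg_nonneg)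
  next
    case True
    define a' where "a' = a + Q a"
    have IH: "\<bar>\<Sum>n=a'..<b. G n\<bar> \<le> (\<eta> + 1 / real K) * real (b - a') + real (card (?bad a' b)) + real T"
      unfolding a'_def using True Q(1)[of a] less.prems by (intro less.hyps) auto
    have split: "(\<Sum>n=a..<b. G n) = (\<Sum>n=a..<a'. G n) + (\<Sum>n=a'..<b. G n)"
      using True unfolding a'_def by (intro sum.atLeastLessThan_concat[symmetric]) auto
    have "1 \<le> real (Q a) / real K + real (card (?bad a a'))"
    proof (cases "Q a \<le> K")
      case True
      hence "{a} \<subseteq> ?bad a a'" using Q(1)[of a] by (auto simp: a'_def)
      hence "card {a} \<le> card (?bad a a')" by (intro card_mono) auto
      thus ?thesis by (simp add: add_increasing)
    next
      case False
      thus ?thesis using K by (simp add: add_increasing2)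
    qed
    hence "\<bar>\<Sum>n=a..<a'. G n\<bar> \<le> (\<eta> + 1 / real K) * real (Q a) + real (card (?bad a a'))"
      using block[of a] less.prems True by (simp add: a'_def ring_distribs)
    moreover have "?bad a b = ?bad a a' \<union> ?bad a' b"
      using True by (auto simp: a'_def)
    hence "card (?bad a b) = card (?bad a a') + card (?bad a' b)"
      by (simp add: card_Un_disjoint disjoint_iff)
    moreover have "real (b - a) = real (Q a) + real (b - a')"
      using True by (simp add: a'_def)
    ultimately show ?thesis using IH unfolding split by (simp add: ring_distribs)
  qed
qed

text \<open>For a fixed fraction \<open>u / q\<close>, the condition confines \<open>y / a^2\<close>
  to a window of length at most \<open>2 / T\<close>. On \<open>[N, 3N)\<close> this function falls
  by at least \<open>2 * y / (27 * N^3)\<close> per unit step, so the admissible \<open>a\<close>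
  lie in one short interval.\<close>

lemma card_bad_slope_le:
  fixes y :: real
  assumes y: "y > 0" and N: "N > 0" and T: "T > 0"
  shows "real (card {a\<in>{N..<3*N}. \<bar>real q * (y / real a ^ 2) - of_int u\<bar> \<le> 1 / real T \<and> 0 < q})
     \<le> 27 * real N ^ 3 / (real T * y) + 1" (is "real (card ?B) \<le> ?L + 1")
proof (cases "?B = {}")
  case True
  show ?thesis unfolding True using y by simp
next
  case False
  have fin: "finite ?B" by simp
  define m where "m = Min ?B"
  have m: "m \<in> ?B" unfolding m_def using fin False by (rule Min_in)
  have "?B \<subseteq> {m..m + nat \<lfloor>?L\<rfloor>}"
  proof
    fix a assume a: "a \<in> ?B"
    have ma: "m \<le> a" unfolding m_def using fin a by (rule Min_le)
    have pos: "0 < m" "0 < a" using m a N by auto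
    have "real q * (y / real m ^ 2 - y / real a ^ 2) \<le> 2 / real T"
      using m a by (auto simp: right_diff_distrib abs_le_iff)
    moreover have "1 * (y / real m ^ 2 - y / real a ^ 2) \<le> real q * (y / real m ^ 2 - y / real a ^ 2)"
      using m ma y pos by (intro mult_right_mono) (auto intro!: divide_left_mono power_mono)
    ultimately have 1: "y / real m ^ 2 - y / real a ^ 2 \<le> 2 / real T"
      unfolding mult_1 by (rule order_trans[rotated])
    \<comment> \<open>The middle expression is the exact factorization of
      \<open>y / m^2 - y / a^2\<close>; it takes the place of the mean value theorem.\<close>
    have "y * (real a - real m) * 2 / (27 * real N ^ 3) \<le> y * (real a - real m) * (1 / (real m * real a ^ 2) + 1 / (real m ^ 2 * real a))"
    proof -
      have le3: "real m \<le> 3 * real N" "real a \<le> 3 * real N" using m a by auto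
      have "real m * real a ^ 2 \<le> 3 * real N * (3 * real N) ^ 2"
           "real m ^ 2 * real a \<le> (3 * real N) ^ 2 * (3 * real N)"
        using le3 by (intro mult_mono power_mono; simp)+
      hence "1 / (27 * real N ^ 3) \<le> 1 / (real m * real a ^ 2)" "1 / (27 * real N ^ 3) \<le> 1 / (real m ^ 2 * real a)"
        using pos N by (auto intro!: divide_left_mono simp: power2_eq_square power3_eq_cube algebra_simps)
      hence "2 / (27 * real N ^ 3) \<le> 1 / (real m * real a ^ 2) + 1 / (real m ^ 2 * real a)" by linarith
      hence "y * (real a - real m) * (2 / (27 * real N ^ 3)) \<le> y * (real a - real m) * (1 / (real m * real a ^ 2) + 1 / (real m ^ 2 * real a))"
        using y ma by (intro mult_left_mono) auto
      thus ?thesis by simp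
    qed
    also have "\<dots> = y / real m ^ 2 - y / real a ^ 2"
      using pos by (simp add: field_simps power2_eq_square)
    also note 1
    finally have "real a - real m \<le> ?L"
      using y N T by (simp add: field_simps)
    thus "a \<in> {m..m + nat \<lfloor>?L\<rfloor>}" using ma by (simp add: le_nat_iff le_floor_iff) linarith
  qed
  hence "card ?B \<le> nat \<lfloor>?L\<rfloor> + 1" using card_mono[of "{m..m + nat \<lfloor>?L\<rfloor>}" ?B] by simp
  moreover have "real (nat \<lfloor>?L\<rfloor>) \<le> ?L" using y by (intro of_nat_floor) simp
  ultimately show ?thesis by linarith
qed

text \<open>The points with a small denominator are covered by the windows belonging to the
  fractions \<open>u / q\<close> with \<open>q \<le> K\<close>. Since \<open>u\<close> is close to
  \<open>q * y / a^2\<close>, few numerators occur.\<close>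

lemma card_small_denominator_le:
  fixes y :: real and Q :: "nat \<Rightarrow> nat" and U :: "nat \<Rightarrow> int"
  assumes y: "y > 0" and N: "N > 0" and T: "T > 0" and Q: "\<And>a. 0 < Q a"
  assumes approx: "\<And>a. \<bar>real (Q a) * (y / real a ^ 2) - of_int (U a)\<bar> < 1 / real T"
  shows "real (card {a\<in>{N..<3*N}. Q a \<le> K})
    \<le> real K * (real K * y / real N ^ 2 + 2) * (27 * real N ^ 3 / (real T * y) + 1)"
proof -
  define B where "B q u = {a\<in>{N..<3*N}. \<bar>real q * (y / real a ^ 2) - of_int u\<bar> \<le> 1 / real T \<and> 0 < q}" for q u
  \<comment> \<open>The \<open>+ 1\<close> allows for the approximation error
    \<open>1 / T \<le> 1\<close>; the numerators \<open>0..V\<close> number at most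
    \<open>K * y / N^2 + 2\<close>.\<close>
  define V where "V = \<lfloor>real K * y / real N ^ 2\<rfloor> + 1"
  have V: "V \<ge> 1" using y by (simp add: V_def)
  have T1: "1 / real T \<le> 1" using T by simp
  have "{a\<in>{N..<3*N}. Q a \<le> K} \<subseteq> (\<Union>(q,u)\<in>{1..K} \<times> {0..V}. B q u)"
  proof
    fix a assume a: "a \<in> {a\<in>{N..<3*N}. Q a \<le> K}"
    have nonneg: "0 \<le> real (Q a) * (y / real a ^ 2)" using y by simp
    have "of_int (U a) > (-1 :: real)" using approx[of a] T1 nonneg by linarith
    hence "0 \<le> U a" by linarith
    moreover have "real (Q a) * (y / real a ^ 2) \<le> real K * (y / real N ^ 2)"
      using a y N by (intro mult_mono divide_left_mono power_mono) auto
    hence "of_int (U a) \<le> real K * y / real N ^ 2 + 1" using approx[of a] T1 by simp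
    hence "U a \<le> V" unfolding V_def by linarith
    moreover have "a \<in> B (Q a) (U a)" using a Q[of a] approx[of a] by (auto simp: B_def)
    ultimately show "a \<in> (\<Union>(q,u)\<in>{1..K} \<times> {0..V}. B q u)"
      using a Q[of a] by (intro UN_I[of "(Q a, U a)"]) (auto simp: Suc_le_eq)
  qed
  hence "card {a\<in>{N..<3*N}. Q a \<le> K} \<le> card (\<Union>(q,u)\<in>{1..K} \<times> {0..V}. B q u)"
    by (intro card_mono) (auto simp: B_def)
  also have "\<dots> \<le> (\<Sum>(q,u)\<in>{1..K} \<times> {0..V}. card (B q u))"
    by (rule order_trans[OF card_UN_le]) (auto simp: case_prod_unfold)
  finally have "real (card {a\<in>{N..<3*N}. Q a \<le> K}) \<le> real (\<Sum>(q,u)\<in>{1..K} \<times> {0..V}. card (B q u))"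
    by (simp only: of_nat_le_iff)
  also have "\<dots> = (\<Sum>p\<in>{1..K} \<times> {0..V}. real (card (B (fst p) (snd p))))"
    by (simp add: case_prod_unfold)
  also have "\<dots> \<le> (\<Sum>p\<in>{1..K} \<times> {0..V}. 27 * real N ^ 3 / (real T * y) + 1)"
    unfolding B_def by (intro sum_mono card_bad_slope_le y N T)
  also have "\<dots> = real K * (of_int V + 1) * (27 * real N ^ 3 / (real T * y) + 1)"
    using V by simp
  also have "\<dots> \<le> real K * (real K * y / real N ^ 2 + 2) * (27 * real N ^ 3 / (real T * y) + 1)"
    using y unfolding V_def by (intro mult_right_mono mult_left_mono) auto
  finally show ?thesis .
qed

text \<open>Dirichlet's theorem attaches to each \<open>a\<close> a fraction near the slope, with
  denominator \<open>Q a \<le> T\<close>, and this denominator is the length of the block starting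
  at \<open>a\<close>. The bound collects the deviation from a progression, the cost
  \<open>1 / K\<close> per element of the long blocks, the number of starting points with
  \<open>Q \<le> K\<close>, and a last incomplete block. The shift \<open>c\<close> does not affect
  the slope.\<close>

lemma sum_frac_hyperbola_bound:
  fixes y c :: real
  assumes y: "y > 0" and N: "N > 0" and T: "T > 0" and K: "K > 0"
  assumes ab: "N \<le> a" "a \<le> b" "b \<le> 3 * N"
  shows "\<bar>\<Sum>n=a..<b. frac (y / real n - c) - 1 / 2\<bar>
    \<le> (2 / real T + 2 * real T ^ 2 * y / real N ^ 3 + 1 / real K) * real (b - a)
      + real K * (real K * y / real N ^ 2 + 2) * (27 * real N ^ 3 / (real T * y) + 1) + real T"
proof -
  have "\<exists>q u. 0 < q \<and> q \<le> T \<and> coprime u (int q) \<and> \<bar>real q * (y / real a ^ 2) - of_int u\<bar> < 1 / real T" for a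
  proof -
    obtain h k where hk: "coprime h k" "0 < k" "k \<le> int T" "\<bar>of_int k * (y / real a ^ 2) - of_int h\<bar> < 1 / real T"
      using Dirichlet_approx_coprime[OF T] by blast
    show ?thesis
      using hk by (intro exI[of _ "nat k"] exI[of _ h]) (auto simp: of_nat_nat)
  qed
  then obtain Q U where QU: "\<And>a. 0 < Q a" "\<And>a. Q a \<le> T" "\<And>a. coprime (U a) (int (Q a))"
      "\<And>a. \<bar>real (Q a) * (y / real a ^ 2) - of_int (U a)\<bar> < 1 / real T"
    by metis
  \<comment> \<open>The first term is the slope error, below \<open>1 / (q * T)\<close> per step
    over fewer than \<open>q\<close> steps; the second is the curvature of \<open>y / n\<close> over
    at most \<open>T\<close> steps.\<close>
  define \<eta> where "\<eta> = 1 / real T + real T ^ 2 * y / real N ^ 3"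
  have \<eta>0: "\<eta> \<ge> 0" using y by (simp add: \<eta>_def)
  have block: "\<bar>\<Sum>n=a..<a+Q a. frac (y / real n - c) - 1 / 2\<bar> \<le> 1 + (2 * \<eta>) * real (Q a)" if a: "N \<le> a" for a
  proof -
    define q where "q = Q a"
    \<comment> \<open>The derivative of \<open>y / n\<close> at \<open>a\<close> is
      \<open>- y / a^2\<close>, hence the sign in front of \<open>U a\<close>.\<close>
    have q: "0 < q" "q \<le> T" "coprime (- U a) (int q)" using QU by (auto simp: q_def)
    have a0: "0 < a" using a N by simp
    have "\<bar>\<Sum>h<q. frac (y / real (a + h) - c) - 1 / 2\<bar> \<le> 1 + 2 * \<eta> * real q"
    proof (rule sum_frac_near_arith_progression[OF q(1,3), where t = "y / real a - c"])
      fix h assume h: "h < q"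
      \<comment> \<open>An exact first order expansion: slope error plus a nonnegative quadratic
        remainder.\<close>
      have "y / real (a + h) - c - (y / real a - c + of_int (- U a) * real h / real q)
          = real h * (of_int (U a) / real q - y / real a ^ 2) + real h ^ 2 * y / (real a ^ 2 * real (a + h))"
        using a0 q by (simp add: divide_simps power2_eq_square) (simp add: algebra_simps)
      moreover have "\<bar>real h * (of_int (U a) / real q - y / real a ^ 2)\<bar> \<le> 1 / real T"
      proof -
        have "real h * (of_int (U a) / real q - y / real a ^ 2)
            = (real h / real q) * (of_int (U a) - real q * (y / real a ^ 2))"
          using q by (simp add: field_simps)
        hence "\<bar>real h * (of_int (U a) / real q - y / real a ^ 2)\<bar>
            = (real h / real q) * \<bar>of_int (U a) - real q * (y / real a ^ 2)\<bar>"
          by (simp add: abs_mult)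
        also have "\<dots> \<le> 1 * (1 / real T)"
          using h QU(4)[of a] by (intro mult_mono) (auto simp: q_def abs_minus_commute)
        finally show ?thesis by simp
      qed
      moreover have "0 \<le> real h ^ 2 * y / (real a ^ 2 * real (a + h))" using y by simp
      moreover have "real h ^ 2 * y / (real a ^ 2 * real (a + h)) \<le> real T ^ 2 * y / real N ^ 3"
      proof (rule frac_le)
        show "real h ^ 2 * y \<le> real T ^ 2 * y" using h q y by (intro mult_right_mono power_mono) auto
        have "real N ^ 2 * real N \<le> real a ^ 2 * real (a + h)" using a by (intro mult_mono power_mono) auto
        thus "real N ^ 3 \<le> real a ^ 2 * real (a + h)" by (simp add: power3_eq_cube power2_eq_square)
      qed (use y N in auto)
      moreover have "\<bar>X\<bar> \<le> e + e'" if "X = P + P'" "\<bar>P\<bar> \<le> e" "0 \<le> P'" "P' \<le> e'" for X P P' e e' :: real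
        using that by linarith
      ultimately show "\<bar>y / real (a + h) - c - (y / real a - c + of_int (- U a) * real h / real q)\<bar> \<le> \<eta>"
        unfolding \<eta>_def by blast
    qed
    also have "(\<Sum>h<q. frac (y / real (a + h) - c) - 1 / 2) = (\<Sum>n=a..<a+q. frac (y / real n - c) - 1 / 2)"
      by (rule sum.reindex_bij_witness[of _ "\<lambda>n. n - a" "\<lambda>h. a + h"]) auto
    finally show ?thesis by (simp add: q_def)
  qed
  have "\<bar>frac (y / real n - c) - 1 / 2\<bar> \<le> 1" for n
    using frac_ge_0[of "y / real n - c"] frac_lt_1[of "y / real n - c"] by linarith
  hence "\<bar>\<Sum>n=a..<b. frac (y / real n - c) - 1 / 2\<bar>
     \<le> (2 * \<eta> + 1 / real K) * real (b - a) + real (card {n\<in>{a..<b}. Q n \<le> K}) + real T"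
    using \<eta>0 K QU(1,2) block ab by (intro sum_greedy_blocks[where N = N]) auto
  also have "real (card {n\<in>{a..<b}. Q n \<le> K}) \<le> real (card {n\<in>{N..<3*N}. Q n \<le> K})"
    using ab by (intro of_nat_mono card_mono) auto
  also have "\<dots> \<le> real K * (real K * y / real N ^ 2 + 2) * (27 * real N ^ 3 / (real T * y) + 1)"
    by (rule card_small_denominator_le[OF y N T QU(1,4)])
  finally show ?thesis by (simp add: \<eta>_def algebra_simps)
qed

text \<open>
  \<open>d\<close> divides \<open>\<lfloor>z\<rfloor>\<close> iff \<open>\<lfloor>z/d\<rfloor> - \<lfloor>(z-1)/d\<rfloor> = 1\<close>. The superfluous \<open>- 0\<close> lets both fractional parts
  match the shifted form of the preceding bound.
\<close>
lemma indicator_dvd_floor: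
  fixes z :: real
  assumes "d > 0" "z \<ge> 0"
  shows "(if d dvd nat \<lfloor>z\<rfloor> then 1 else 0 :: real)
    = 1 / real d - (frac (z / real d - 0) - 1 / 2) + (frac (z / real d - 1 / real d) - 1 / 2)"
proof -
  define m where "m = \<lfloor>z\<rfloor>"
  have m: "m \<ge> 0" using assms by (simp add: m_def)
  have f1: "\<lfloor>z / real d\<rfloor> = m div int d"
    unfolding m_def using floor_divide_real_eq_div[of "int d" z] by simp
  have "z / real d - 1 / real d = (z - 1) / real d" by (simp add: diff_divide_distrib)
  hence f2: "\<lfloor>z / real d - 1 / real d\<rfloor> = (m - 1) div int d"
    unfolding m_def using floor_divide_real_eq_div[of "int d" "z - 1"] by simp
  have dvd_iff: "d dvd nat m \<longleftrightarrow> int d dvd m"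
    using m by (metis int_dvd_int_iff nat_0_le)
  have "(if d dvd nat m then 1 else 0) = m div int d - (m - 1) div int d"
  proof (cases "int d dvd m")
    case True
    then obtain k where k: "m = int d * k" by blast
    have "(m - 1) div int d = k - 1"
      using assms by (intro int_div_pos_eq[where r = "int d - 1"]) (auto simp: k algebra_simps)
    moreover have "m div int d = k" using assms by (simp add: k)
    ultimately have "1 = m div int d - (m - 1) div int d" by linarith
    moreover have "d dvd nat m" using True dvd_iff by blast
    ultimately show ?thesis by (simp only: if_True)
  next
    case False
    define r where "r = m mod int d"
    have r: "0 < r" "r < int d"
    proof -
      have "r \<noteq> 0" unfolding r_def using False by (metis mod_0_imp_dvd)
      moreover have "0 \<le> r" unfolding r_def using assms by (intro pos_mod_sign) simp
      ultimately show "0 < r" by linarith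
      show "r < int d" unfolding r_def using assms by (intro pos_mod_bound) simp
    qed
    have eq: "m = int d * (m div int d) + r" by (simp add: r_def)
    have "(m - 1) div int d = m div int d"
      by (rule int_div_pos_eq[where r = "r - 1"]) (use eq r in linarith)+
    thus ?thesis using False by (simp add: dvd_iff)
  qed
  hence "(if d dvd nat m then 1 else 0 :: real) = of_int (m div int d) - of_int ((m - 1) div int d)"
    by (smt (verit) of_int_0 of_int_1 of_int_diff)
  thus ?thesis by (simp add: frac_def f1 f2 flip: m_def)
qed

text \<open>Summing the indicator over \<open>n\<close> leaves the expected count and two fractional
  part sums along the hyperbola \<open>(x/d) / n\<close>, with shifts \<open>0\<close> and
  \<open>1/d\<close>; hence the factor 2.\<close>

lemma card_dvd_floor_bound:
  fixes x :: real
  assumes x: "x > 0" and d: "d > 0" and N: "N > 0" and T: "T > 0" and K: "K > 0"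
  assumes ab: "N \<le> a" "a \<le> b" "b \<le> 3 * N"
  shows "\<bar>real (card {n\<in>{a..<b}. d dvd nat \<lfloor>x / real n\<rfloor>}) - real (b - a) / real d\<bar>
    \<le> 2 * ((2 / real T + 2 * real T ^ 2 * (x / real d) / real N ^ 3 + 1 / real K) * real (b - a)
      + real K * (real K * (x / real d) / real N ^ 2 + 2) * (27 * real N ^ 3 / (real T * (x / real d)) + 1) + real T)"
    (is "_ \<le> 2 * ?E")
proof -
  let ?s = "\<lambda>c. \<Sum>n=a..<b. frac (x / real d / real n - c) - 1 / 2"
  have "real (card {n\<in>{a..<b}. d dvd nat \<lfloor>x / real n\<rfloor>}) = (\<Sum>n=a..<b. if d dvd nat \<lfloor>x / real n\<rfloor> then 1 else 0)"
    by (simp add: sum.If_cases Int_def)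
  also have "\<dots> = (\<Sum>n=a..<b. 1 / real d - (frac (x / real d / real n - 0) - 1 / 2) + (frac (x / real d / real n - 1 / real d) - 1 / 2))"
    using x d by (subst indicator_dvd_floor) (auto simp: mult.commute)
  also have "\<dots> = real (b - a) / real d - ?s 0 + ?s (1 / real d)"
    by (simp only: sum.distrib sum_subtractf) simp
  finally have "real (card {n\<in>{a..<b}. d dvd nat \<lfloor>x / real n\<rfloor>}) - real (b - a) / real d = ?s (1 / real d) - ?s 0"
    by simp
  also have "\<bar>\<dots>\<bar> \<le> ?E + ?E"
    using x d by (intro order_trans[OF abs_triangle_ineq4] add_mono sum_frac_hyperbola_bound N T K ab) simp_all
  finally show ?thesis by (simp only: mult_2)
qed

section \<open>The totient along the quotients of a large number\<close>

text \<open>The choice \<open>b = 2^k\<close> in the bound for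
  \<open>b ^ card (prime_factors n)\<close> makes its left side a \<open>k\<close>-th power. Stating
  the hypothesis through \<open>z ^ k\<close> avoids real roots.\<close>

lemma power_prime_factors_subpolynomial:
  fixes k :: nat
  assumes "k > 0"
  shows "\<exists>C>0. \<forall>v>0. \<forall>z\<ge>0. real v \<le> z ^ k \<longrightarrow> 2 ^ card (prime_factors v) \<le> C * z"
proof -
  define b :: nat where "b = 2 ^ k"
  define C where "C = real (b ^ b)"
  have b: "b > 0" by (simp add: b_def)
  have C: "C \<ge> 1" using b by (simp add: C_def del: of_nat_power)
  have "2 ^ card (prime_factors v) \<le> C * z" if v: "v > 0" "z \<ge> 0" "real v \<le> z ^ k" for v z
  proof -
    have "(2 ^ card (prime_factors v)) ^ k = real (b ^ card (prime_factors v))"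
      by (simp add: b_def power_mult[symmetric] mult.commute)
    also have "\<dots> \<le> real (b ^ b * v)"
      using power_card_prime_factors_le[OF v(1) b] by (simp only: of_nat_le_iff)
    also have "\<dots> \<le> C * z ^ k" using v(3) by (simp add: C_def mult_left_mono)
    \<comment> \<open>Weakening \<open>C\<close> to \<open>C ^ k\<close> makes the right side a
      \<open>k\<close>-th power too, ready for taking roots.\<close>
    also have "\<dots> \<le> C ^ k * z ^ k"
      using C v(2) assms by (intro mult_right_mono self_le_power) auto
    finally have "(2 ^ card (prime_factors v)) ^ k \<le> (C * z) ^ k"
      by (simp only: power_mult_distrib)
    thus ?thesis
      by (rule power_mono_iff[THEN iffD1, rotated 3]) (use assms C v in auto)
  qed
  thus ?thesis using C by (intro exI[of _ C]) auto
qed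

text \<open>The omitted divisors exceed \<open>t\<close>, so each contributes at most
  \<open>1 / t\<close>, and only the squarefree ones, at most
  \<open>2 ^ card (prime_factors v)\<close> in number, contribute at all.\<close>

lemma totient_truncated_divisor_sum:
  assumes "v > 0" "t > 0"
  shows "\<bar>real (totient v) / real v - (\<Sum>d=1..t. if d dvd v then moebius_mu d / real d else 0)\<bar>
    \<le> 2 ^ card (prime_factors v) / real t"
proof -
  let ?f = "\<lambda>d. moebius_mu d / real d"
  have "real (totient v) / real v = (\<Sum>d | d dvd v. ?f d)"
    using totient_eq_sum_moebius_mu[OF assms(1)] assms by simp
  also have "{d. d dvd v} = {d\<in>{1..t}. d dvd v} \<union> {d. d dvd v \<and> d > t}"
    using assms by (auto simp: Suc_le_eq intro: Nat.gr0I)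
  also have "(\<Sum>d\<in>\<dots>. ?f d) = (\<Sum>d\<in>{d\<in>{1..t}. d dvd v}. ?f d) + (\<Sum>d | d dvd v \<and> d > t. ?f d)"
    using assms by (intro sum.union_disjoint) auto
  also have "(\<Sum>d\<in>{d\<in>{1..t}. d dvd v}. ?f d) = (\<Sum>d=1..t. if d dvd v then ?f d else 0)"
    by (intro sum.inter_filter) auto
  finally have "\<bar>real (totient v) / real v - (\<Sum>d=1..t. if d dvd v then ?f d else 0)\<bar>
      = \<bar>\<Sum>d | d dvd v \<and> d > t. ?f d\<bar>" by simp
  also have "(\<Sum>d | d dvd v \<and> d > t. ?f d) = (\<Sum>d | d dvd v \<and> squarefree d \<and> d > t. ?f d)"
    using assms by (intro sum.mono_neutral_right) (auto simp: moebius_mu_def)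
  also have "\<bar>\<dots>\<bar> \<le> (\<Sum>d | d dvd v \<and> squarefree d \<and> d > t. 1 / real t)"
  proof (intro order_trans[OF sum_abs] sum_mono)
    fix d assume d: "d \<in> {d. d dvd v \<and> squarefree d \<and> d > t}"
    have "\<bar>?f d\<bar> \<le> 1 / real d" by (simp add: divide_right_mono abs_moebius_mu_le)
    also have "\<dots> \<le> 1 / real t" using d assms by (intro divide_left_mono) auto
    finally show "\<bar>?f d\<bar> \<le> 1 / real t" .
  qed
  also have "\<dots> = real (card {d. d dvd v \<and> squarefree d \<and> d > t}) / real t" by simp
  also have "card {d. d dvd v \<and> squarefree d \<and> d > t} \<le> card {d. d dvd v \<and> squarefree d}"
    using assms by (intro card_mono) auto
  also have "card {d. d dvd v \<and> squarefree d} = 2 ^ card (prime_factors v)"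
    by (rule card_squarefree_divisors[OF assms(1)])
  finally show ?thesis by (simp add: divide_right_mono)
qed

text \<open>
  Here \<open>t\<close> plays the role of \<open>x^(1/1000)\<close>. The exponent \<open>340\<close> makes \<open>x/N^3\<close> at most \<open>2 t^(-20)\<close>, and \<open>499\<close>
  makes \<open>x/(d N^2)\<close> at least \<open>1\<close> for \<open>d \<le> t\<close>; the general bound is used with \<open>T = t^6\<close> and \<open>K = t^2\<close>.
\<close>
lemma card_dvd_floor_power_bound:
  fixes x :: real
  assumes t: "t > 0" and d: "1 \<le> d" "d \<le> t"
  assumes x: "real t ^ 1000 \<le> x" "x \<le> 2 * real t ^ 1000"
  assumes N: "t ^ 340 \<le> N" "N \<le> t ^ 499" and ab: "N \<le> a" "a \<le> b" "b \<le> 3 * N"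
  shows "\<bar>real (card {n\<in>{a..<b}. d dvd nat \<lfloor>x / real n\<rfloor>}) - real (b - a) / real d\<bar> \<le> 204 * real N / real t ^ 2"
proof -
  define u where "u = real t"
  define y where "y = x / real d"
  define n where "n = real N"
  have u: "u \<ge> 1" using t by (simp add: u_def)
  have Npos: "N > 0" using N(1) t by (intro Nat.gr0I) auto
  have n: "u ^ 340 \<le> n" "n \<le> u ^ 499"
    using N unfolding n_def u_def of_nat_power[symmetric] by (simp_all only: of_nat_le_iff)
  have n0: "n > 0" using Npos by (simp add: n_def)
  have x0: "x > 0" using x(1) t by (smt (verit) of_nat_0_less_iff zero_less_power)
  have d0: "real d \<ge> 1" "real d \<le> u" using d by (auto simp: u_def)
  have y_le: "y \<le> 2 * u ^ 1000"
  proof -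
    have "y \<le> x / 1" unfolding y_def using d0 x0 by (intro divide_left_mono) auto
    thus ?thesis using x by (simp add: u_def)
  qed
  have y_ge: "u ^ 999 \<le> y"
  proof -
    have "u ^ 999 * real d \<le> u ^ 999 * u" using d0 u by (intro mult_left_mono) auto
    also have "\<dots> = u ^ Suc 999" by (rule power_Suc2[symmetric])
    also have "\<dots> \<le> x" using x by (simp add: u_def)
    finally show ?thesis unfolding y_def using d0 by (simp add: field_simps)
  qed
  have y0: "y > 0" using x0 d0 by (simp add: y_def)
  have n3: "u ^ 1020 \<le> n ^ 3"
  proof -
    have "u ^ 1020 = (u ^ 340) ^ 3" by (simp flip: power_mult)
    also have "\<dots> \<le> n ^ 3" using n u by (intro power_mono) auto
    finally show ?thesis .
  qed
  \<comment> \<open>The limit 18 is what \<open>j + 1000 + 2 \<le> 1020\<close> permits. The case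
    \<open>j = 12\<close> serves the square of \<open>T = t^6\<close>, and \<open>j = 4\<close> the
    square of \<open>K = t^2\<close>.\<close>
  have pw: "u ^ j * y * u ^ 2 \<le> 2 * n ^ 3" if "j \<le> 18" for j
  proof -
    have "u ^ j * y * u ^ 2 \<le> u ^ j * (2 * u ^ 1000) * u ^ 2"
      using y_le u by (intro mult_right_mono mult_left_mono) auto
    also have "\<dots> = 2 * u ^ (j + 1000 + 2)" by (simp add: power_add)
    also have "\<dots> \<le> 2 * u ^ 1020" using that u by (intro mult_left_mono power_increasing) auto
    also have "\<dots> \<le> 2 * n ^ 3" using n3 by simp
    finally show ?thesis .
  qed
  define s where "s = y / n ^ 2"
  have s1: "s \<ge> 1"
  proof -
    have "n ^ 2 \<le> (u ^ 499) ^ 2" using n n0 by (intro power_mono) auto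
    also have "\<dots> = u ^ 998" by (simp flip: power_mult)
    also have "\<dots> \<le> u ^ 999" using u by (intro power_increasing) auto
    also have "\<dots> \<le> y" by (rule y_ge)
    finally show ?thesis using n0 by (simp add: s_def)
  qed
  have e1: "2 / u ^ 6 \<le> 2 / u ^ 2"
    using u by (intro divide_left_mono power_increasing) auto
  have e2: "2 * (u ^ 6) ^ 2 * y / n ^ 3 \<le> 4 / u ^ 2"
  proof -
    have "(u ^ 6) ^ 2 = u ^ 12" by (simp flip: power_mult)
    thus ?thesis using pw[of 12] n0 u by (simp add: field_simps)
  qed
  have E1: "(2 / u ^ 6 + 2 * (u ^ 6) ^ 2 * y / n ^ 3 + 1 / u ^ 2) * real (b - a) \<le> 14 * n / u ^ 2"
  proof -
    have "2 / u ^ 6 + 2 * (u ^ 6) ^ 2 * y / n ^ 3 + 1 / u ^ 2 \<le> 2 / u ^ 2 + 4 / u ^ 2 + 1 / u ^ 2"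
      using e1 e2 by (intro add_mono) auto
    also have "\<dots> = 7 / u ^ 2" by (simp add: field_simps)
    finally have "(2 / u ^ 6 + 2 * (u ^ 6) ^ 2 * y / n ^ 3 + 1 / u ^ 2) * real (b - a) \<le> 7 / u ^ 2 * (2 * n)"
      using ab u by (intro mult_mono) (auto simp: n_def)
    thus ?thesis by simp
  qed
  \<comment> \<open>As \<open>u^2 * s \<ge> 1\<close>, the summand 2 is absorbed into
    \<open>3 * u^2 * s\<close>. Expanding the product then gives \<open>81 * n / u^2\<close> and at
    most \<open>6 * n / u^2\<close>, together 87.\<close>
  have E2: "u ^ 2 * (u ^ 2 * y / n ^ 2 + 2) * (27 * n ^ 3 / (u ^ 6 * y) + 1) \<le> 87 * n / u ^ 2"
  proof -
    have us: "1 \<le> u ^ 2 * s" using mult_mono[of 1 "u ^ 2" 1 s] u s1 by simp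
    have "u ^ 2 * (u ^ 2 * y / n ^ 2 + 2) \<le> u ^ 2 * (3 * (u ^ 2 * s))"
      using us by (intro mult_left_mono) (auto simp: s_def)
    hence "u ^ 2 * (u ^ 2 * y / n ^ 2 + 2) * (27 * n ^ 3 / (u ^ 6 * y) + 1)
        \<le> u ^ 2 * (3 * (u ^ 2 * s)) * (27 * n ^ 3 / (u ^ 6 * y) + 1)"
      using n0 y0 u by (intro mult_right_mono) auto
    also have "\<dots> = 81 * (u ^ 4 * s * n ^ 3 / (u ^ 6 * y)) + 3 * (u ^ 4 * s)"
      by (simp add: algebra_simps flip: power_add)
    also have "u ^ 4 * s * n ^ 3 / (u ^ 6 * y) = n / u ^ 2"
    proof -
      have "u ^ 6 = u ^ 4 * u ^ 2" by (simp flip: power_add)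
      thus ?thesis using n0 y0 u by (simp add: s_def power2_eq_square power3_eq_cube)
    qed
    also have "u ^ 4 * s \<le> 2 * n / u ^ 2"
      using pw[of 4] n0 u by (simp add: s_def field_simps power2_eq_square power3_eq_cube)
    finally show ?thesis by simp
  qed
  have E3: "u ^ 6 \<le> n / u ^ 2"
  proof -
    have "u ^ 6 * u ^ 2 = u ^ 8" by (simp flip: power_add)
    also have "\<dots> \<le> u ^ 340" using u by (intro power_increasing) auto
    also have "\<dots> \<le> n" by (rule n(1))
    finally show ?thesis using u by (simp add: field_simps)
  qed
  have "\<bar>real (card {n\<in>{a..<b}. d dvd nat \<lfloor>x / real n\<rfloor>}) - real (b - a) / real d\<bar>
    \<le> 2 * ((2 / real (t ^ 6) + 2 * real (t ^ 6) ^ 2 * (x / real d) / real N ^ 3 + 1 / real (t ^ 2)) * real (b - a)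
      + real (t ^ 2) * (real (t ^ 2) * (x / real d) / real N ^ 2 + 2) * (27 * real N ^ 3 / (real (t ^ 6) * (x / real d)) + 1) + real (t ^ 6))"
    using t d x0 Npos by (intro card_dvd_floor_bound ab) auto
  also have "\<dots> = 2 * ((2 / u ^ 6 + 2 * (u ^ 6) ^ 2 * y / n ^ 3 + 1 / u ^ 2) * real (b - a)
      + u ^ 2 * (u ^ 2 * y / n ^ 2 + 2) * (27 * n ^ 3 / (u ^ 6 * y) + 1) + u ^ 6)"
    by (simp only: of_nat_power u_def y_def n_def)
  also have "\<dots> \<le> 2 * (14 * n / u ^ 2 + 87 * n / u ^ 2 + n / u ^ 2)"
    using E1 E2 E3 by (intro mult_left_mono add_mono) auto
  also have "\<dots> = 204 * n / u ^ 2" by simp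
  finally show ?thesis by (simp add: n_def u_def)
qed

section \<open>The mean of phi(v) / v on blocks comparable to their starting point\<close>

definition totient_density :: "real \<Rightarrow> nat \<Rightarrow> real" where
  "totient_density x n = real (totient (nat \<lfloor>x / real n\<rfloor>)) / real (nat \<lfloor>x / real n\<rfloor>)"

text \<open>Pinning \<open>x\<close> between \<open>t^1000\<close> and twice that turns fractional
  powers of \<open>x\<close> into natural powers of the integer \<open>t\<close>. The factor 3 in
  \<open>b \<le> 3 * N\<close>, instead of 2, leaves room for halving odd numbers, and
  \<open>real b \<le> x\<close> keeps all quotients \<open>\<lfloor>x/n\<rfloor>\<close>
  positive.\<close>

definition admissible_block :: "real \<Rightarrow> nat \<Rightarrow> nat \<Rightarrow> nat \<Rightarrow> nat \<Rightarrow> bool" where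
  "admissible_block x t N a b \<longleftrightarrow>
     real t ^ 1000 \<le> x \<and> x \<le> 2 * real t ^ 1000 \<and> t ^ 340 \<le> N \<and> N \<le> t ^ 499 \<and>
     N \<le> a \<and> a \<le> b \<and> b \<le> 3 * N \<and> real b \<le> x"

text \<open>The divisor sum for \<open>phi(v) / v\<close> is cut at \<open>t\<close> and the order
  of summation exchanged. Each of the \<open>t\<close> moduli costs \<open>204 * N / t^2\<close> by
  equidistribution; the cut costs \<open>O(1 / sqrt t)\<close> per term on at most
  \<open>2 * N\<close> terms.\<close>

lemma sum_totient_density_bound:
  "\<exists>C>0. \<forall>t>0. \<forall>x N a b. admissible_block x t N a b \<longrightarrow>
   \<bar>(\<Sum>n=a..<b. totient_density x n) - (\<Sum>d=1..t. moebius_mu d / real d ^ 2) * real (b - a)\<bar>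
     \<le> (204 / real t + C / sqrt (real t)) * real N"
proof -
  \<comment> \<open>The exponent 2000 makes the divisor bound \<open>O(sqrt t)\<close>, because
    \<open>t^1000\<close> is the 2000th power of \<open>sqrt t\<close>; dividing by the cut
    \<open>t\<close> still saves \<open>sqrt t\<close>.\<close>
  obtain C where C: "C > 0" "\<And>v z. v > 0 \<Longrightarrow> z \<ge> 0 \<Longrightarrow> real v \<le> z ^ 2000 \<Longrightarrow> 2 ^ card (prime_factors v) \<le> C * z"
    using power_prime_factors_subpolynomial[of 2000] by auto
  have "\<bar>(\<Sum>n=a..<b. totient_density x n) - (\<Sum>d=1..t. moebius_mu d / real d ^ 2) * real (b - a)\<bar>
     \<le> (204 / real t + (4 * C) / sqrt (real t)) * real N"
    if t: "t > 0" and block: "admissible_block x t N a b" for t N a b :: nat and x :: real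
  proof -
    have x: "real t ^ 1000 \<le> x" "x \<le> 2 * real t ^ 1000" and N: "t ^ 340 \<le> N" "N \<le> t ^ 499"
      and ab: "N \<le> a" "a \<le> b" "b \<le> 3 * N" and bx: "real b \<le> x"
      using block by (simp_all add: admissible_block_def)
    let ?v = "\<lambda>n. nat \<lfloor>x / real n\<rfloor>"
    let ?W = "\<lambda>n. \<Sum>d=1..t. if d dvd ?v n then moebius_mu d / real d else 0"
    have Npos: "N > 0" using N(1) t by (intro Nat.gr0I) auto
    have trunc: "\<bar>totient_density x n - ?W n\<bar> \<le> 2 * C / sqrt (real t)" if n: "n \<in> {a..<b}" for n
    proof -
      have n1: "real n \<ge> 1" using n ab Npos by auto
      have nx: "real n \<le> x" using n bx by simp
      hence v: "?v n > 0" using n1 by (simp add: zero_less_nat_eq le_floor_iff field_simps)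
      have "real (?v n) \<le> x / real n" using nx n1 by (intro of_nat_floor) auto
      also have "\<dots> \<le> x / 1" using n1 nx by (intro divide_left_mono) auto
      also have "\<dots> \<le> 2 * (sqrt (real t) ^ 2) ^ 1000" using x by simp
      also have "\<dots> = 2 * sqrt (real t) ^ 2000" by (simp only: power_mult[symmetric]) simp
      also have "\<dots> \<le> 2 ^ 2000 * sqrt (real t) ^ 2000" by (intro mult_right_mono self_le_power) auto
      also have "\<dots> = (2 * sqrt (real t)) ^ 2000" by (rule power_mult_distrib[symmetric])
      finally have "2 ^ card (prime_factors (?v n)) \<le> C * (2 * sqrt (real t))"
        using v by (intro C(2)) auto
      hence "2 ^ card (prime_factors (?v n)) / real t \<le> C * (2 * sqrt (real t)) / real t"
        by (intro divide_right_mono) auto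
      also have "\<dots> = 2 * C / sqrt (real t)"
        using t by (simp add: field_simps real_sqrt_mult_self flip: power2_eq_square)
      finally show ?thesis
        using totient_truncated_divisor_sum[OF v t] unfolding totient_density_def by linarith
    qed
    have "(\<Sum>n=a..<b. ?W n) = (\<Sum>d=1..t. \<Sum>n=a..<b. if d dvd ?v n then moebius_mu d / real d else 0)"
      by (rule sum.swap)
    also have "\<dots> = (\<Sum>d=1..t. moebius_mu d / real d * real (card {n\<in>{a..<b}. d dvd ?v n}))"
      by (intro sum.cong refl) (simp add: sum.If_cases Int_def)
    finally have "(\<Sum>n=a..<b. ?W n) - (\<Sum>d=1..t. moebius_mu d / real d ^ 2) * real (b - a)
        = (\<Sum>d=1..t. moebius_mu d / real d * (real (card {n\<in>{a..<b}. d dvd ?v n}) - real (b - a) / real d))"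
      by (simp add: sum_distrib_right sum_subtractf right_diff_distrib power2_eq_square)
    also have "\<bar>\<dots>\<bar> \<le> (\<Sum>d=1..t. 204 * real N / real t ^ 2)"
    proof (intro order_trans[OF sum_abs] sum_mono)
      fix d assume d: "d \<in> {1..t}"
      have "\<bar>moebius_mu d / real d\<bar> \<le> 1 / 1"
        unfolding abs_divide using d abs_moebius_mu_le by (intro frac_le) auto
      hence "\<bar>moebius_mu d / real d\<bar> * \<bar>real (card {n\<in>{a..<b}. d dvd ?v n}) - real (b - a) / real d\<bar>
          \<le> 1 * (204 * real N / real t ^ 2)"
        using d by (intro mult_mono card_dvd_floor_power_bound t x N ab) auto
      thus "\<bar>moebius_mu d / real d * (real (card {n\<in>{a..<b}. d dvd ?v n}) - real (b - a) / real d)\<bar>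
          \<le> 204 * real N / real t ^ 2" by (simp add: abs_mult)
    qed
    also have "\<dots> = 204 * real N / real t" using t by (simp add: power2_eq_square)
    finally have main: "\<bar>(\<Sum>n=a..<b. ?W n) - (\<Sum>d=1..t. moebius_mu d / real d ^ 2) * real (b - a)\<bar> \<le> 204 * real N / real t" .
    have "\<bar>(\<Sum>n=a..<b. totient_density x n) - (\<Sum>n=a..<b. ?W n)\<bar> \<le> (\<Sum>n=a..<b. 2 * C / sqrt (real t))"
      unfolding sum_subtractf[symmetric] by (intro order_trans[OF sum_abs] sum_mono trunc)
    also have "\<dots> = real (b - a) * (2 * C / sqrt (real t))" by simp
    also have "\<dots> \<le> (2 * real N) * (2 * C / sqrt (real t))"
      using ab C by (intro mult_right_mono) auto
    finally have "\<bar>(\<Sum>n=a..<b. totient_density x n) - (\<Sum>n=a..<b. ?W n)\<bar> \<le> 4 * C / sqrt (real t) * real N"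
      by (simp add: mult_ac)
    thus ?thesis using main by (simp add: ring_distribs)
  qed
  thus ?thesis using C(1) by (intro exI[of _ "4 * C"]) auto
qed

text \<open>The partial sum of \<open>mu(d) / d^2\<close> up to \<open>t\<close> may be replaced by
  its limit, since it depends on \<open>t\<close> alone; this keeps the estimate uniform in
  \<open>x\<close> and in the block.\<close>

lemma sum_totient_density_dyadic:
  assumes "\<epsilon> > 0"
  shows "\<forall>\<^sub>F t in sequentially. \<forall>x N a b. admissible_block x t N a b \<longrightarrow>
   \<bar>\<Sum>n=a..<b. totient_density x n - 1 / riemann_zeta 2\<bar> \<le> \<epsilon> * real N"
proof -
  obtain C where C: "\<forall>t>0. \<forall>x N a b. admissible_block x t N a b \<longrightarrow>
      \<bar>(\<Sum>n=a..<b. totient_density x n) - (\<Sum>d=1..t. moebius_mu d / real d ^ 2) * real (b - a)\<bar>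
        \<le> (204 / real t + C / sqrt (real t)) * real N"
    using sum_totient_density_bound by (elim exE conjE) (rule that)
  let ?M = "\<lambda>t. \<Sum>d=1..t. moebius_mu d / real d ^ 2"
  let ?c = "1 / riemann_zeta 2"
  have "(\<lambda>t. 204 / real t + C / sqrt (real t)) \<longlonglongrightarrow> 0" by real_asymp
  moreover have "(\<lambda>t. 2 * \<bar>?M t - ?c\<bar>) \<longlonglongrightarrow> 2 * \<bar>?c - ?c\<bar>"
    by (intro tendsto_intros sum_moebius_mu_squares_tendsto)
  ultimately have "(\<lambda>t. 204 / real t + C / sqrt (real t) + 2 * \<bar>?M t - ?c\<bar>) \<longlonglongrightarrow> 0 + 2 * \<bar>?c - ?c\<bar>"
    by (rule tendsto_add)
  hence "\<forall>\<^sub>F t in sequentially. 204 / real t + C / sqrt (real t) + 2 * \<bar>?M t - ?c\<bar> < \<epsilon>"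
    using assms by (intro order_tendstoD(2)[where y = "0 + 2 * \<bar>?c - ?c\<bar>"]) auto
  thus ?thesis using eventually_gt_at_top[of 0]
  proof eventually_elim
    case (elim t)
    show ?case
    proof (intro allI impI)
      fix x N a b
      assume block: "admissible_block x t N a b"
      hence *: "a \<le> b" "b \<le> 3 * N" "N \<le> a" by (auto simp: admissible_block_def)
      have "(\<Sum>n=a..<b. totient_density x n - ?c)
         = ((\<Sum>n=a..<b. totient_density x n) - ?M t * real (b - a)) + (?M t - ?c) * real (b - a)"
        by (simp add: sum_subtractf left_diff_distrib)
      also have "\<bar>\<dots>\<bar> \<le> (204 / real t + C / sqrt (real t)) * real N + \<bar>?M t - ?c\<bar> * (2 * real N)"
      proof (intro order_trans[OF abs_triangle_ineq] add_mono)
        show "\<bar>(\<Sum>n=a..<b. totient_density x n) - ?M t * real (b - a)\<bar> \<le> (204 / real t + C / sqrt (real t)) * real N"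
          using elim block by (intro C[rule_format]) auto
        show "\<bar>(?M t - ?c) * real (b - a)\<bar> \<le> \<bar>?M t - ?c\<bar> * (2 * real N)"
          unfolding abs_mult using * by (intro mult_left_mono) auto
      qed
      also have "\<dots> = (204 / real t + C / sqrt (real t) + 2 * \<bar>?M t - ?c\<bar>) * real N"
        by (simp add: algebra_simps)
      also have "\<dots> \<le> \<epsilon> * real N" using elim by (intro mult_right_mono) auto
      finally show "\<bar>\<Sum>n=a..<b. totient_density x n - ?c\<bar> \<le> \<epsilon> * real N" .
    qed
  qed
qed

section \<open>From dyadic blocks to harmonic weights, and the middle range\<close>

lemma dyadic_sum_bound:
  fixes f :: "nat \<Rightarrow> real"
  assumes A: "A > 0" and \<epsilon>: "\<epsilon> \<ge> 0"
  assumes dyadic: "\<And>N b. A \<le> N \<Longrightarrow> N \<le> b \<Longrightarrow> b \<le> 3 * N \<Longrightarrow> b \<le> B \<Longrightarrow> \<bar>\<Sum>n=N..<b. f n\<bar> \<le> \<epsilon> * real N"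
  assumes "A \<le> m" "m \<le> B"
  shows "\<bar>\<Sum>n=A..<m. f n\<bar> \<le> 2 * \<epsilon> * real m"
  using assms(4,5)
proof (induction m rule: less_induct)
  case (less m)
  show ?case
  proof (cases "m \<le> 3 * A")
    case True
    have "\<bar>\<Sum>n=A..<m. f n\<bar> \<le> \<epsilon> * real A" using True less.prems by (intro dyadic) auto
    also have "\<dots> \<le> (2 * \<epsilon>) * real m" using less.prems \<epsilon> by (intro mult_mono) auto
    finally show ?thesis .
  next
    case False
    \<comment> \<open>The upper half is one block, the lower half falls to the induction hypothesis,
      and \<open>2 * N + N \<le> 2 * m\<close> keeps the constant 2. From \<open>m > 3 * A\<close>
      follows \<open>A \<le> N\<close>, and \<open>m \<le> 2 * N + 1 \<le> 3 * N\<close>.\<close>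
    define N where "N = m div 2"
    have N: "A \<le> N" "N < m" "m \<le> 3 * N" "2 * N \<le> m" using False A by (auto simp: N_def)
    have "(\<Sum>n=A..<m. f n) = (\<Sum>n=A..<N. f n) + (\<Sum>n=N..<m. f n)"
      using N by (intro sum.atLeastLessThan_concat[symmetric]) auto
    also have "\<bar>\<dots>\<bar> \<le> 2 * \<epsilon> * real N + \<epsilon> * real N"
      using N less.prems by (intro order_trans[OF abs_triangle_ineq] add_mono less.IH dyadic) auto
    also have "\<dots> = \<epsilon> * (3 * real N)" by simp
    also have "\<dots> \<le> \<epsilon> * (2 * real m)" using N \<epsilon> by (intro mult_left_mono) auto
    finally show ?thesis by (simp add: mult_ac)
  qed
qed

text \<open>Partial summation in inductive form: with the boundary term \<open>?E m / m\<close>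
  subtracted, passing to \<open>m + 1\<close> adds just \<open>?E (m+1) / (m * (m+1))\<close>, which
  is at most \<open>\<delta> / m\<close> in absolute value.\<close>

lemma abel_harmonic_bound:
  fixes f :: "nat \<Rightarrow> real"
  assumes A: "A > 0" and \<delta>: "\<delta> \<ge> 0"
  assumes bound: "\<And>m. A \<le> m \<Longrightarrow> m \<le> B \<Longrightarrow> \<bar>\<Sum>n=A..<m. f n\<bar> \<le> \<delta> * real m"
  assumes "A \<le> B"
  shows "\<bar>\<Sum>n=A..<B. f n / real n\<bar> \<le> \<delta> * (1 + (\<Sum>n=A..<B. 1 / real n))"
proof -
  let ?E = "\<lambda>m. \<Sum>n=A..<m. f n"
  have "\<bar>(\<Sum>n=A..<m. f n / real n) - ?E m / real m\<bar> \<le> \<delta> * (\<Sum>n=A..<m. 1 / real n)" if "A \<le> m" "m \<le> B" for m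
    using that
  proof (induction m rule: dec_induct)
    case (step m)
    have m0: "m > 0" using step A by simp
    have "(\<Sum>n=A..<Suc m. f n / real n) - ?E (Suc m) / real (Suc m)
        = ((\<Sum>n=A..<m. f n / real n) - ?E m / real m) + ?E (Suc m) / (real m * real (Suc m))"
      using step m0 by (simp add: divide_simps) (simp add: algebra_simps)
    also have "\<bar>\<dots>\<bar> \<le> \<delta> * (\<Sum>n=A..<m. 1 / real n) + \<delta> * real (Suc m) / (real m * real (Suc m))"
    proof (intro order_trans[OF abs_triangle_ineq] add_mono)
      show "\<bar>(\<Sum>n=A..<m. f n / real n) - ?E m / real m\<bar> \<le> \<delta> * (\<Sum>n=A..<m. 1 / real n)"
        using step by simp
      show "\<bar>?E (Suc m) / (real m * real (Suc m))\<bar> \<le> \<delta> * real (Suc m) / (real m * real (Suc m))"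
        unfolding abs_divide abs_mult abs_of_nat using step
        by (intro divide_right_mono bound) auto
    qed
    also have "\<delta> * real (Suc m) / (real m * real (Suc m)) = \<delta> * (1 / real m)" by simp
    finally show ?case using step by (simp add: ring_distribs)
  qed simp
  from this[of B] have 1: "\<bar>(\<Sum>n=A..<B. f n / real n) - ?E B / real B\<bar> \<le> \<delta> * (\<Sum>n=A..<B. 1 / real n)"
    using assms by simp
  have "\<bar>?E B / real B\<bar> \<le> \<delta> * real B / real B"
    unfolding abs_divide abs_of_nat using assms by (intro divide_right_mono bound) auto
  hence 2: "\<bar>?E B / real B\<bar> \<le> \<delta>" using assms by simp
  have "(\<Sum>n=A..<B. f n / real n) = ((\<Sum>n=A..<B. f n / real n) - ?E B / real B) + ?E B / real B"
    by simp
  also have "\<bar>\<dots>\<bar> \<le> \<delta> * (\<Sum>n=A..<B. 1 / real n) + \<delta>"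
    by (intro order_trans[OF abs_triangle_ineq] add_mono 1 2)
  finally show ?thesis by (simp add: ring_distribs)
qed

lemma sum_inverse_bounds:
  assumes "0 < A" "A \<le> B"
  shows "ln (real B) - ln (real A) \<le> (\<Sum>n=A..<B. 1 / real n)"
    and "(\<Sum>n=A..<B. 1 / real n) \<le> 1 + ln (real B) - ln (real A)"
proof -
  \<comment> \<open>The upper bound carries \<open>1 / A - 1 / B\<close> because the step needs
    \<open>1 / (m+1) \<le> ln (m+1) - ln m\<close>; the difference is bounded by 1
    afterwards.\<close>
  have "ln (real B) - ln (real A) \<le> (\<Sum>n=A..<B. 1 / real n) \<and>
      (\<Sum>n=A..<B. 1 / real n) \<le> 1 / real A - 1 / real B + ln (real B) - ln (real A)"
    using assms(2)
  proof (induction B rule: dec_induct)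
    case (step m)
    have m: "m > 0" using step assms by simp
    have "ln (real m + 1) - ln (real m) < 1 / real m" using m by (intro ln_diff_le_inverse) auto
    moreover have "ln (real m / (real m + 1)) \<le> real m / (real m + 1) - 1"
      using m by (intro ln_le_minus_one) auto
    hence "1 / (real m + 1) \<le> ln (real m + 1) - ln (real m)"
      using m by (simp add: ln_div field_simps)
    ultimately show ?case using step by (simp add: add.commute)
  qed simp
  moreover have "1 / real A - 1 / real B \<le> 1" using assms
  proof -
    have "1 / real A \<le> 1 / 1" using assms by (intro divide_left_mono) auto
    moreover have "1 / real B \<ge> 0" by simp
    ultimately show ?thesis by linarith
  qed
  ultimately show "ln (real B) - ln (real A) \<le> (\<Sum>n=A..<B. 1 / real n)"
    and "(\<Sum>n=A..<B. 1 / real n) \<le> 1 + ln (real B) - ln (real A)" by linarith+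
qed

text \<open>Here \<open>phi(v)\<close> is its density times \<open>v\<close>, and \<open>v\<close>
  is \<open>x / n\<close> up to 1, so the sum is \<open>x\<close> times a harmonic average of
  densities. The number 159 is \<open>499 - 340\<close>. The summand 2 collects the rounding of
  \<open>x / n\<close> over at most \<open>x\<close> terms and the error of the harmonic
  sum.\<close>

lemma sum_totient_middle_range:
  assumes \<delta>: "\<delta> > 0"
  shows "\<forall>\<^sub>F t in sequentially. \<forall>x. real t ^ 1000 \<le> x \<longrightarrow> x \<le> 2 * real t ^ 1000 \<longrightarrow>
    \<bar>(\<Sum>n=t^340..<t^499. real (totient (nat \<lfloor>x / real n\<rfloor>))) - 1 / riemann_zeta 2 * x * (159 * ln (real t))\<bar>
      \<le> x * (2 + \<delta> * (2 + 499 * ln (real t)))"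
proof -
  let ?c = "1 / riemann_zeta 2"
  have c: "0 \<le> ?c" "?c \<le> 1" using riemann_zeta_2_ge by auto
  have "\<forall>\<^sub>F t in sequentially. \<forall>x N a b. admissible_block x t N a b \<longrightarrow>
      \<bar>\<Sum>n=a..<b. totient_density x n - ?c\<bar> \<le> (\<delta> / 2) * real N"
    using \<delta> by (intro sum_totient_density_dyadic) auto
  thus ?thesis using eventually_ge_at_top[of 1]
  proof eventually_elim
    case (elim t)
    show ?case
    proof (intro allI impI)
      fix x assume x: "real t ^ 1000 \<le> x" "x \<le> 2 * real t ^ 1000"
      define A B where "A = t ^ 340" and "B = t ^ 499"
      let ?v = "\<lambda>n. nat \<lfloor>x / real n\<rfloor>"
      have t: "t \<ge> 1" by fact
      have A0: "A > 0" using t by (simp add: A_def)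
      have AB: "A \<le> B" unfolding A_def B_def using t by (intro power_increasing) auto
      have Bx: "real B \<le> x"
      proof -
        have "real B = real t ^ 499" by (simp add: B_def)
        also have "\<dots> \<le> real t ^ 1000" using t by (intro power_increasing) auto
        finally show ?thesis using x(1) by linarith
      qed
      have x0: "x > 0" using Bx A0 AB by linarith
      have lnA: "ln (real A) = 340 * ln (real t)" and lnB: "ln (real B) = 499 * ln (real t)"
        unfolding A_def B_def using t by (simp_all add: ln_realpow)
      have lnt: "ln (real t) \<ge> 0" using t by simp
      define H where "H = (\<Sum>n=A..<B. 1 / real n)"
      have H: "159 * ln (real t) \<le> H" "H \<le> 1 + 159 * ln (real t)"
        using sum_inverse_bounds[OF A0 AB] by (simp_all add: H_def lnA lnB)
      \<comment> \<open>The dyadic decomposition doubles the constant, which is why the block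
        estimate was taken with \<open>\<delta> / 2\<close>.\<close>
      have "\<bar>\<Sum>n=A..<m. totient_density x n - ?c\<bar> \<le> 2 * (\<delta> / 2) * real m" if "A \<le> m" "m \<le> B" for m
      proof (rule dyadic_sum_bound[OF A0, where B = B])
        fix N b assume "A \<le> N" "N \<le> b" "b \<le> 3 * N" "b \<le> B"
        moreover have "real b \<le> x" using \<open>b \<le> B\<close> Bx by linarith
        ultimately have "admissible_block x t N N b"
          using x by (auto simp: admissible_block_def A_def B_def)
        thus "\<bar>\<Sum>n=N..<b. totient_density x n - ?c\<bar> \<le> (\<delta> / 2) * real N" using elim by blast
      qed (use \<delta> that in auto)
      hence "\<bar>\<Sum>n=A..<B. (totient_density x n - ?c) / real n\<bar> \<le> \<delta> * (1 + H)"
        unfolding H_def using \<delta> A0 AB by (intro abel_harmonic_bound) auto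
      also have "(\<Sum>n=A..<B. (totient_density x n - ?c) / real n) = (\<Sum>n=A..<B. totient_density x n / real n) - ?c * H"
        by (simp add: H_def sum_subtractf diff_divide_distrib sum_distrib_left)
      also have "\<delta> * (1 + H) \<le> \<delta> * (2 + 499 * ln (real t))"
        using H lnt \<delta> by (intro mult_left_mono) auto
      finally have "x * \<bar>(\<Sum>n=A..<B. totient_density x n / real n) - ?c * H\<bar> \<le> x * (\<delta> * (2 + 499 * ln (real t)))"
        using x0 by (intro mult_left_mono) auto
      hence main: "\<bar>x * ((\<Sum>n=A..<B. totient_density x n / real n) - ?c * H)\<bar> \<le> x * (\<delta> * (2 + 499 * ln (real t)))"
        using x0 by (simp add: abs_mult)
      have "\<bar>(\<Sum>n=A..<B. real (totient (?v n))) - (\<Sum>n=A..<B. x * (totient_density x n / real n))\<bar> \<le> (\<Sum>n=A..<B. 1)"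
        unfolding sum_subtractf[symmetric]
      proof (intro order_trans[OF sum_abs] sum_mono)
        fix n assume n: "n \<in> {A..<B}"
        have n0: "n > 0" using n A0 by auto
        have "real n \<le> x" using n Bx by simp
        hence v: "?v n > 0" using n0 by (simp add: zero_less_nat_eq le_floor_iff field_simps)
        have g: "0 \<le> totient_density x n" "totient_density x n \<le> 1"
          using v totient_le[of "?v n"] unfolding totient_density_def
          by (simp_all only: divide_le_eq_1_pos of_nat_0_less_iff of_nat_le_iff divide_nonneg_nonneg of_nat_0_le_iff)
        have "real (totient (?v n)) = totient_density x n * real (?v n)"
          unfolding totient_density_def
          by (rule sym, rule nonzero_eq_divide_eq[THEN iffD1, OF _ refl]) (use v in linarith)
        hence "real (totient (?v n)) - x * (totient_density x n / real n) = totient_density x n * (real (?v n) - x / real n)"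
          by (simp only: right_diff_distrib) simp
        also have "\<bar>\<dots>\<bar> = totient_density x n * \<bar>real (?v n) - x / real n\<bar>"
          using g by (simp add: abs_mult)
        also have "\<dots> \<le> 1 * 1"
        proof (intro mult_mono)
          have "real (?v n) = of_int \<lfloor>x / real n\<rfloor>" using x0 by simp
          thus "\<bar>real (?v n) - x / real n\<bar> \<le> 1" by linarith
        qed (use g in auto)
        finally show "\<bar>real (totient (?v n)) - x * (totient_density x n / real n)\<bar> \<le> 1" by simp
      qed
      also have "\<dots> \<le> x" using Bx by simp
      finally have rough: "\<bar>(\<Sum>n=A..<B. real (totient (?v n))) - x * (\<Sum>n=A..<B. totient_density x n / real n)\<bar> \<le> x"
        by (simp add: sum_distrib_left)
      have "\<bar>?c * (H - 159 * ln (real t))\<bar> \<le> 1 * 1"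
        unfolding abs_mult using c H by (intro mult_mono) auto
      hence "x * \<bar>?c * (H - 159 * ln (real t))\<bar> \<le> x * 1" using x0 by (intro mult_left_mono) auto
      hence harm: "\<bar>x * (?c * (H - 159 * ln (real t)))\<bar> \<le> x" using x0 by (simp add: abs_mult)
      have "(\<Sum>n=A..<B. real (totient (?v n))) - ?c * x * (159 * ln (real t))
         = ((\<Sum>n=A..<B. real (totient (?v n))) - x * (\<Sum>n=A..<B. totient_density x n / real n))
           + (x * ((\<Sum>n=A..<B. totient_density x n / real n) - ?c * H) + x * (?c * (H - 159 * ln (real t))))"
        by (simp add: algebra_simps)
      also have "\<bar>\<dots>\<bar> \<le> x + (x * (\<delta> * (2 + 499 * ln (real t))) + x)"
        by (intro order_trans[OF abs_triangle_ineq] add_mono rough main harm)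
      finally show "\<bar>(\<Sum>n=t^340..<t^499. real (totient (?v n))) - ?c * x * (159 * ln (real t))\<bar>
          \<le> x * (2 + \<delta> * (2 + 499 * ln (real t)))"
        unfolding A_def B_def by (simp add: algebra_simps)
    qed
  qed
qed

section \<open>Large n, grouped by the value of the quotient\<close>

lemma sum_floor_quotient_by_value:
  fixes x :: real and F :: "nat \<Rightarrow> real"
  assumes x: "x > 0"
  shows "(\<Sum>n=1..nat \<lfloor>x\<rfloor>. F (nat \<lfloor>x / real n\<rfloor>))
    = (\<Sum>n=1..nat \<lfloor>x / real (R + 1)\<rfloor>. F (nat \<lfloor>x / real n\<rfloor>))
      + (\<Sum>v=1..R. F v * (of_int \<lfloor>x / real v\<rfloor> - of_int \<lfloor>x / real (v + 1)\<rfloor>))"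
proof (induction R)
  case (Suc R)
  let ?f = "\<lambda>n. F (nat \<lfloor>x / real n\<rfloor>)"
  define a b where "a = nat \<lfloor>x / real (Suc R + 1)\<rfloor>" and "b = nat \<lfloor>x / real (R + 1)\<rfloor>"
  have "x / real (Suc R + 1) \<le> x / real (R + 1)" using x by (intro divide_left_mono) auto
  hence ab: "a \<le> b" unfolding a_def b_def by (intro nat_mono floor_mono)
  have a_eq: "real a = of_int \<lfloor>x / real (Suc R + 1)\<rfloor>" and b_eq: "real b = of_int \<lfloor>x / real (R + 1)\<rfloor>"
    using x unfolding a_def b_def by simp_all
  \<comment> \<open>Raising the cutoff from \<open>R\<close> to \<open>R + 1\<close> removes exactly
    the \<open>n\<close> whose quotient has integer part \<open>R + 1\<close>.\<close>
  have "{1..b} = {1..a} \<union> {a<..b}" using ab by auto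
  hence "(\<Sum>n=1..b. ?f n) = (\<Sum>n=1..a. ?f n) + (\<Sum>n\<in>{a<..b}. ?f n)"
    by (simp add: sum.union_disjoint disjoint_iff)
  also have "(\<Sum>n\<in>{a<..b}. ?f n) = (\<Sum>n\<in>{a<..b}. F (R + 1))"
  proof (intro sum.cong refl)
    fix n assume n: "n \<in> {a<..b}"
    have "real n \<le> x / real (R + 1)"
    proof -
      have "real n \<le> real b" using n by simp
      also have "\<dots> \<le> x / real (R + 1)" unfolding b_eq by (rule of_int_floor_le)
      finally show ?thesis .
    qed
    moreover have "x / real (Suc R + 1) < real n"
    proof -
      have "x / real (Suc R + 1) < real a + 1" unfolding a_eq by linarith
      also have "\<dots> \<le> real n" using n by simp
      finally show ?thesis .
    qed
    moreover have "n > 0" using n by simp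
    ultimately have "real (R + 1) \<le> x / real n" "x / real n < real (R + 1) + 1"
      by (simp_all add: field_simps)
    hence "\<lfloor>x / real n\<rfloor> = int (R + 1)" by (intro floor_unique) auto
    thus "?f n = F (R + 1)" by (simp only: nat_int)
  qed
  also have "\<dots> = F (R + 1) * (real b - real a)" using ab by simp
  finally show ?case using Suc.IH unfolding b_def[symmetric] a_def[symmetric]
    by (simp add: a_eq b_eq)
qed simp

text \<open>The number of \<open>n\<close> with quotient \<open>v\<close> is
  \<open>x / (v * (v+1))\<close> up to 1, and \<open>phi(v) \<le> R\<close>, so the total rounding
  error is at most \<open>R^2 \<le> x\<close>. The rest is the logarithmic average of the totient,
  with \<open>ln R\<close> equal to \<open>ln x / 2\<close> up to a bounded error.\<close>

lemma sum_totient_values_asymp: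
  assumes \<epsilon>: "\<epsilon> > 0"
  shows "\<forall>\<^sub>F x in at_top. \<forall>R. R = nat \<lfloor>sqrt x\<rfloor> \<longrightarrow>
    \<bar>(\<Sum>v=1..R. real (totient v) * (of_int \<lfloor>x / real v\<rfloor> - of_int \<lfloor>x / real (v + 1)\<rfloor>))
       - 1 / riemann_zeta 2 * x * (ln x / 2)\<bar> \<le> \<epsilon> * x * ln x"
proof -
  let ?c = "1 / riemann_zeta 2"
  let ?M = "\<lambda>R. \<Sum>d=1..R. moebius_mu d / real d ^ 2"
  have c: "0 \<le> ?c" "?c \<le> 1" using riemann_zeta_2_ge by auto
  obtain C where C: "\<And>R. R > 0 \<Longrightarrow> \<bar>(\<Sum>v=1..R. real (totient v) / (real v * real (v + 1))) - ln (real R) * ?M R\<bar> \<le> C"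
    using sum_totient_values_bound by blast
  have sqrt_top: "filterlim (\<lambda>x. nat \<lfloor>sqrt x\<rfloor>) at_top at_top"
    by (intro filterlim_compose[OF filterlim_nat_sequentially] filterlim_compose[OF filterlim_floor_sequentially] sqrt_at_top)
  have "((\<lambda>x. ?M (nat \<lfloor>sqrt x\<rfloor>)) \<longlongrightarrow> ?c) at_top"
    by (rule filterlim_compose[OF sum_moebius_mu_squares_tendsto sqrt_top])
  hence "\<forall>\<^sub>F x in at_top. dist (?M (nat \<lfloor>sqrt x\<rfloor>)) ?c < \<epsilon>"
    using \<epsilon> by (rule tendstoD)
  \<comment> \<open>Besides \<open>C\<close>, one unit stands for the rounding error
    \<open>x\<close> and one for replacing \<open>ln R\<close> by \<open>ln x / 2\<close>.\<close>
  moreover have "\<forall>\<^sub>F x::real in at_top. C + 2 \<le> \<epsilon> / 2 * ln x" using \<epsilon> by real_asymp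
  ultimately show ?thesis using eventually_ge_at_top[of "4::real"]
  proof eventually_elim
    case (elim x)
    define R where "R = nat \<lfloor>sqrt x\<rfloor>"
    have x: "x \<ge> 4" by fact
    have s: "sqrt x \<ge> 2" using x by (simp add: real_le_rsqrt)
    have R: "real R \<le> sqrt x" "sqrt x < real R + 1" using s unfolding R_def by linarith+
    have R0: "R > 0" using R s by linarith
    have lnx: "ln x > 0" using x by simp
    define T where "T = (\<Sum>v=1..R. real (totient v) * (of_int \<lfloor>x / real v\<rfloor> - of_int \<lfloor>x / real (v + 1)\<rfloor>))"
    define U where "U = (\<Sum>v=1..R. real (totient v) / (real v * real (v + 1)))"
    have "\<bar>T - (\<Sum>v=1..R. real (totient v) * (x / (real v * real (v + 1))))\<bar> \<le> (\<Sum>v=1..R. real R)"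
      unfolding T_def sum_subtractf[symmetric]
    proof (intro order_trans[OF sum_abs] sum_mono)
      fix v assume v: "v \<in> {1..R}"
      have eq: "x / (real v * real (v + 1)) = x / real v - x / real (v + 1)"
        using v by (simp add: divide_simps) (simp add: algebra_simps)
      have "real (totient v) * (of_int \<lfloor>x / real v\<rfloor> - of_int \<lfloor>x / real (v + 1)\<rfloor>) - real (totient v) * (x / (real v * real (v + 1)))
        = real (totient v) * (frac (x / real (v + 1)) - frac (x / real v))"
        unfolding eq by (simp add: frac_def algebra_simps)
      also have "\<bar>\<dots>\<bar> \<le> real R * 1"
        unfolding abs_mult
      proof (intro mult_mono)
        show "\<bar>real (totient v)\<bar> \<le> real R" using totient_le[of v] v by simp
        show "\<bar>frac (x / real (v + 1)) - frac (x / real v)\<bar> \<le> 1"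
          using frac_ge_0[of "x / real (v + 1)"] frac_lt_1[of "x / real (v + 1)"]
            frac_ge_0[of "x / real v"] frac_lt_1[of "x / real v"] by linarith
      qed auto
      finally show "\<bar>real (totient v) * (of_int \<lfloor>x / real v\<rfloor> - of_int \<lfloor>x / real (v + 1)\<rfloor>) - real (totient v) * (x / (real v * real (v + 1)))\<bar> \<le> real R"
        by simp
    qed
    also have "(\<Sum>v=1..R. real R) = real R * real R" by simp
    also have "\<dots> \<le> sqrt x * sqrt x" using R x by (intro mult_mono) auto
    also have "\<dots> = x" using x by simp
    also have "(\<Sum>v=1..R. real (totient v) * (x / (real v * real (v + 1)))) = x * U"
      by (simp add: U_def sum_distrib_left mult_ac)
    finally have 1: "\<bar>T - x * U\<bar> \<le> x" .
    have 2: "\<bar>U - ln (real R) * ?M R\<bar> \<le> C" unfolding U_def by (rule C[OF R0])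
    have lnR: "ln (real R) \<le> ln x / 2" "ln x / 2 \<le> ln (real R) + 1" "ln (real R) \<ge> 0"
    proof -
      have "ln (real R) \<le> ln (sqrt x)" using R R0 x by (subst ln_le_cancel_iff) auto
      thus "ln (real R) \<le> ln x / 2" using x by (simp add: ln_sqrt)
      have "ln (sqrt x) \<le> ln (real R + 1)" using R x by (subst ln_le_cancel_iff) auto
      moreover have "ln (real R + 1) - ln (real R) < 1 / real R" using R0 by (intro ln_diff_le_inverse) auto
      moreover have "1 / real R \<le> 1" using R0 by simp
      ultimately have "ln (sqrt x) \<le> ln (real R) + 1" by linarith
      thus "ln x / 2 \<le> ln (real R) + 1" using x by (simp add: ln_sqrt)
      show "ln (real R) \<ge> 0" using R0 by simp
    qed
    have 3: "\<bar>ln (real R) * (?M R - ?c)\<bar> \<le> ln x / 2 * \<epsilon>"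
      unfolding abs_mult using lnR elim(1) by (intro mult_mono) (auto simp: dist_real_def R_def)
    have 4: "\<bar>?c * (ln (real R) - ln x / 2)\<bar> \<le> 1 * 1"
      unfolding abs_mult using c lnR by (intro mult_mono) auto
    have "U - ?c * (ln x / 2) = (U - ln (real R) * ?M R) + (ln (real R) * (?M R - ?c) + ?c * (ln (real R) - ln x / 2))"
      by (simp add: algebra_simps)
    also have "\<bar>\<dots>\<bar> \<le> C + (ln x / 2 * \<epsilon> + 1 * 1)"
      by (intro order_trans[OF abs_triangle_ineq] add_mono 2 3 4)
    finally have "x * \<bar>U - ?c * (ln x / 2)\<bar> \<le> x * (C + (ln x / 2 * \<epsilon> + 1 * 1))"
      using x by (intro mult_left_mono) auto
    hence 5: "\<bar>x * (U - ?c * (ln x / 2))\<bar> \<le> x * (C + (ln x / 2 * \<epsilon> + 1 * 1))"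
      using x by (simp add: abs_mult)
    have "T - ?c * x * (ln x / 2) = (T - x * U) + x * (U - ?c * (ln x / 2))"
      by (simp add: algebra_simps)
    also have "\<bar>\<dots>\<bar> \<le> x + x * (C + (ln x / 2 * \<epsilon> + 1 * 1))"
      by (intro order_trans[OF abs_triangle_ineq] add_mono 1 5)
    also have "\<dots> = x * (C + 2 + \<epsilon> / 2 * ln x)" by (simp add: algebra_simps)
    also have "\<dots> \<le> x * (\<epsilon> / 2 * ln x + \<epsilon> / 2 * ln x)" using elim x by (intro mult_left_mono) auto
    also have "\<dots> = \<epsilon> * x * ln x" by (simp add: algebra_simps)
    finally show ?case unfolding T_def R_def by blast
  qed
qed

lemma sum_totient_trivial_bound:
  fixes x :: real
  assumes "x > 0" "0 < a" "a \<le> b"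
  shows "(\<Sum>n=a..<b. real (totient (nat \<lfloor>x / real n\<rfloor>))) \<le> x * (1 + ln (real b) - ln (real a))"
proof -
  have "(\<Sum>n=a..<b. real (totient (nat \<lfloor>x / real n\<rfloor>))) \<le> (\<Sum>n=a..<b. x * (1 / real n))"
  proof (intro sum_mono)
    fix n
    have "real (totient (nat \<lfloor>x / real n\<rfloor>)) \<le> real (nat \<lfloor>x / real n\<rfloor>)" by (simp add: totient_le)
    also have "\<dots> \<le> x / real n" using assms by (intro of_nat_floor) auto
    finally show "real (totient (nat \<lfloor>x / real n\<rfloor>)) \<le> x * (1 / real n)" by simp
  qed
  also have "\<dots> = x * (\<Sum>n=a..<b. 1 / real n)" by (simp add: sum_distrib_left)
  also have "\<dots> \<le> x * (1 + ln (real b) - ln (real a))"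
    using assms sum_inverse_bounds(2)[OF assms(2,3)] by (intro mult_left_mono) auto
  finally show ?thesis .
qed

section \<open>Assembly of the ranges and numerical comparison\<close>

lemma riemann_zeta_2_le: "riemann_zeta 2 \<le> 2"
  using zeta_2_tail[of 1] by simp

text \<open>With \<open>c = 1 / riemann_zeta 2\<close>, the estimates give the coefficients
  \<open>0.659 * c + 0.341\<close> above and \<open>0.659 * c\<close> below, up to small errors. At
  \<open>c = 1\<close> the upper one would equal its target, so \<open>c \<le> 4/5\<close> supplies
  room there; \<open>c \<ge> 1/2\<close> supplies it below.\<close>

lemma S_bounds:
  "\<forall>\<^sub>F x in at_top.
     real (S x) \<le> (2629 / 4009 * (1 / riemann_zeta 2) + 1380 / 4009) * (x * ln x) \<and>
     real (S x) \<ge> (2629 / 4009 * (1 / riemann_zeta 2)) * (x * ln x)"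
proof -
  define c where "c = 1 / riemann_zeta 2"
  have c: "1 / 2 \<le> c" "c \<le> 4 / 5"
    using riemann_zeta_2_ge riemann_zeta_2_le unfolding c_def by (simp_all add: field_simps)
  \<comment> \<open>The margins are about \<open>0.0032 * (1 - c)\<close> above and
    \<open>0.0032 * c\<close> below, so at least \<open>0.0006\<close>; the error terms come to
    about \<open>0.00015\<close>.\<close>
  define \<epsilon> :: real where "\<epsilon> = 1 / 10000"
  define scale where "scale x = nat \<lfloor>x powr (1 / 1000)\<rfloor>" for x :: real
  have scale_top: "filterlim scale at_top at_top"
    unfolding scale_def
    by (intro filterlim_compose[OF filterlim_nat_sequentially] filterlim_compose[OF filterlim_floor_sequentially]) real_asymp
  have "\<forall>\<^sub>F x in at_top. \<forall>y. real (scale x) ^ 1000 \<le> y \<longrightarrow> y \<le> 2 * real (scale x) ^ 1000 \<longrightarrow>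
    \<bar>(\<Sum>n=scale x^340..<scale x^499. real (totient (nat \<lfloor>y / real n\<rfloor>))) - c * y * (159 * ln (real (scale x)))\<bar>
      \<le> y * (2 + \<epsilon> * (2 + 499 * ln (real (scale x))))"
    unfolding c_def
    by (intro eventually_compose_filterlim[OF sum_totient_middle_range scale_top]) (simp add: \<epsilon>_def)
  moreover have "\<forall>\<^sub>F x in at_top. \<forall>R. R = nat \<lfloor>sqrt x\<rfloor> \<longrightarrow>
    \<bar>(\<Sum>v=1..R. real (totient v) * (of_int \<lfloor>x / real v\<rfloor> - of_int \<lfloor>x / real (v + 1)\<rfloor>))
       - c * x * (ln x / 2)\<bar> \<le> \<epsilon> * x * ln x"
    unfolding c_def by (rule sum_totient_values_asymp) (simp add: \<epsilon>_def)
  \<comment> \<open>For \<open>t \<ge> 2000\<close> the logarithms of \<open>x\<close> and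
    \<open>t^1000\<close> differ by at most \<open>1000 / t \<le> 1/2\<close>, which is below
    \<open>ln 2\<close>; hence \<open>x \<le> 2 * t^1000\<close>.\<close>
  moreover have "\<forall>\<^sub>F x in at_top. scale x \<ge> 2000"
    using scale_top by (simp add: filterlim_at_top)
  moreover have "\<forall>\<^sub>F x::real in at_top. ln x \<ge> 1000000" by real_asymp
  ultimately show ?thesis using eventually_ge_at_top[of "4::real"]
  proof eventually_elim
    case (elim x)
    define t where "t = scale x"
    define L where "L = ln x"
    define l where "l = ln (real t)"
    have x: "x \<ge> 4" and L: "L \<ge> 1000000" and t: "t \<ge> 2000" using elim by (simp_all add: L_def t_def)
    define w where "w = x powr (1 / 1000)"
    have w: "w ^ 1000 = x" unfolding w_def using x by (simp add: powr_realpow[symmetric] powr_powr)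
    have w0: "w \<ge> 0" by (simp add: w_def)
    have tw: "real t \<le> w" "w < real t + 1" using w0 unfolding t_def scale_def w_def[symmetric] by linarith+
    have t_le: "real t ^ 1000 \<le> x" unfolding w[symmetric] using tw by (intro power_mono) auto
    have ln_w: "ln x = 1000 * ln w"
      unfolding w[symmetric] using tw t by (simp add: ln_realpow)
    have "ln (real t + 1) - ln (real t) < 1 / real t" using t by (intro ln_diff_le_inverse) auto
    moreover have "1 / real t \<le> 1 / 2000" using t by (intro divide_left_mono) auto
    moreover have "ln w \<le> ln (real t + 1)" using tw t by (subst ln_le_cancel_iff) auto
    moreover have "ln (real t) \<le> ln w" using tw t by (subst ln_le_cancel_iff) auto
    ultimately have l: "1000 * l \<le> L" "L \<le> 1000 * l + 1 / 2" unfolding L_def ln_w l_def by linarith+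
    have t_ge: "x \<le> 2 * real t ^ 1000"
    proof -
      have "ln 2 \<ge> (1 / 2 :: real)" using ln2_ge_two_thirds by simp
      hence "ln x \<le> ln 2 + 1000 * ln (real t)" using l by (simp add: L_def l_def)
      also have "\<dots> = ln (2 * real t ^ 1000)" using t by (simp add: ln_mult ln_realpow)
      finally show ?thesis using x t by (subst (asm) ln_le_cancel_iff) auto
    qed
    define R where "R = nat \<lfloor>sqrt x\<rfloor>"
    \<comment> \<open>The indices up to \<open>Z\<close> are those with quotient at least
      \<open>R + 1\<close>; all others are grouped by value.\<close>
    define Z where "Z = nat \<lfloor>x / real (R + 1)\<rfloor>"
    define f where "f n = real (totient (nat \<lfloor>x / real n\<rfloor>))" for n
    define A B where "A = t ^ 340" and "B = t ^ 499"
    define V where "V = (\<Sum>v=1..R. real (totient v) * (of_int \<lfloor>x / real v\<rfloor> - of_int \<lfloor>x / real (v + 1)\<rfloor>))"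
    have A0: "A > 0" using t by (simp add: A_def)
    have AB: "A \<le> B" unfolding A_def B_def using t by (intro power_increasing) auto
    have s: "sqrt x \<ge> 2" using x by (simp add: real_le_rsqrt)
    have R: "real R \<le> sqrt x" "sqrt x < real R + 1" using s unfolding R_def by linarith+
    have Z_le: "real Z \<le> x / real (R + 1)" unfolding Z_def using x by (intro of_nat_floor) auto
    have Z_le_sqrt: "real Z \<le> sqrt x"
    proof -
      have "x / real (R + 1) \<le> x / sqrt x" using R x by (intro divide_left_mono) auto
      also have "\<dots> = sqrt x" using x by (simp add: real_div_sqrt)
      finally show ?thesis using Z_le by linarith
    qed
    have sqrt_ge: "real t ^ 500 \<le> sqrt x"
    proof -
      have "(real t ^ 500) ^ 2 = real t ^ 1000" by (simp flip: power_mult)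
      thus ?thesis using t_le by (intro real_le_rsqrt) simp
    qed
    \<comment> \<open>The ranges are correctly ordered: \<open>t^499 \<le> sqrt x / 2\<close>, while
      \<open>x / (R + 1)\<close> is at least \<open>sqrt x / 2\<close>.\<close>
    have BZ: "B \<le> Z"
    proof -
      have "real B * 2 \<le> real t ^ 499 * real t" unfolding B_def of_nat_power using t by (intro mult_left_mono) auto
      also have "\<dots> = real t ^ Suc 499" by (rule power_Suc2[symmetric])
      also have "\<dots> \<le> sqrt x" using sqrt_ge by simp
      finally have "real B \<le> sqrt x / 2" by simp
      also have "\<dots> = x / (2 * sqrt x)" using x by (simp add: real_div_sqrt)
      also have "\<dots> \<le> x / real (R + 1)" using R s x by (intro divide_left_mono) auto
      finally have "of_int (int B) \<le> x / real (R + 1)" by simp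
      hence "int B \<le> \<lfloor>x / real (R + 1)\<rfloor>" by (simp only: le_floor_iff)
      thus ?thesis unfolding Z_def by linarith
    qed
    have S_eq: "real (S x) = (\<Sum>n=1..<A. f n) + (\<Sum>n=A..<B. f n) + (\<Sum>n=B..<Z+1. f n) + V"
    proof -
      have "{n. 1 \<le> n \<and> real n \<le> x} = {1..nat \<lfloor>x\<rfloor>}" using x by (auto simp: le_nat_iff le_floor_iff)
      hence "real (S x) = (\<Sum>n=1..nat \<lfloor>x\<rfloor>. f n)" by (simp add: S_def f_def)
      also have "\<dots> = (\<Sum>n=1..Z. f n) + V"
        unfolding f_def V_def Z_def using x sum_floor_quotient_by_value[of x "\<lambda>v. real (totient v)" R] by simp
      also have "{1..Z} = {1..<Z+1}" by auto
      also have "(\<Sum>n=1..<Z+1. f n) = (\<Sum>n=1..<A. f n) + (\<Sum>n=A..<Z+1. f n)"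
        using A0 AB BZ by (intro sum.atLeastLessThan_concat[symmetric]) auto
      also have "(\<Sum>n=A..<Z+1. f n) = (\<Sum>n=A..<B. f n) + (\<Sum>n=B..<Z+1. f n)"
        using AB BZ by (intro sum.atLeastLessThan_concat[symmetric]) auto
      finally show ?thesis by simp
    qed
    have low: "0 \<le> (\<Sum>n=1..<A. f n)" "(\<Sum>n=1..<A. f n) \<le> x * (1 + 340 * l)"
    proof -
      show "0 \<le> (\<Sum>n=1..<A. f n)" by (simp add: f_def sum_nonneg)
      have "(\<Sum>n=1..<A. f n) \<le> x * (1 + ln (real A) - ln (real 1))"
        unfolding f_def using x A0 by (intro sum_totient_trivial_bound) auto
      also have "ln (real A) = 340 * l" unfolding A_def l_def using t by (simp add: ln_realpow)
      finally show "(\<Sum>n=1..<A. f n) \<le> x * (1 + 340 * l)" by simp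
    qed
    \<comment> \<open>From \<open>t^499\<close> to about \<open>sqrt x\<close>, roughly
      \<open>t^500\<close>, the logarithmic length is only \<open>l + O(1)\<close>, a thousandth of
      \<open>ln x\<close>.\<close>
    have gap: "0 \<le> (\<Sum>n=B..<Z+1. f n)" "(\<Sum>n=B..<Z+1. f n) \<le> x * (3 + l)"
    proof -
      show "0 \<le> (\<Sum>n=B..<Z+1. f n)" by (simp add: f_def sum_nonneg)
      have "(\<Sum>n=B..<Z+1. f n) \<le> x * (1 + ln (real (Z+1)) - ln (real B))"
        unfolding f_def using x A0 AB BZ by (intro sum_totient_trivial_bound) auto
      also have "ln (real B) = 499 * l" unfolding B_def l_def using t by (simp add: ln_realpow)
      also have "x * (1 + ln (real (Z+1)) - 499 * l) \<le> x * (3 + l)"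
      proof (intro mult_left_mono)
        have "real (Z + 1) \<le> 2 * sqrt x" using Z_le_sqrt s by simp
        hence "ln (real (Z + 1)) \<le> ln (2 * sqrt x)" using x by (subst ln_le_cancel_iff) auto
        also have "\<dots> = ln 2 + L / 2" using x by (simp add: ln_mult ln_sqrt L_def)
        finally show "1 + ln (real (Z + 1)) - 499 * l \<le> 3 + l" using l ln_2_less_1 by linarith
      qed (use x in auto)
      finally show "(\<Sum>n=B..<Z+1. f n) \<le> x * (3 + l)" .
    qed
    have mid: "\<bar>(\<Sum>n=A..<B. f n) - c * x * (159 * l)\<bar> \<le> x * (2 + \<epsilon> * (2 + 499 * l))"
      using elim(1) t_le t_ge unfolding A_def B_def f_def l_def t_def by blast
    have val: "\<bar>V - c * x * (L / 2)\<bar> \<le> \<epsilon> * x * L"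
      using elim(2) unfolding V_def L_def R_def by blast
    have "c * L \<le> c * (1000 * l + 1 / 2)" "c * (1000 * l) \<le> c * L" using c l by (intro mult_left_mono; simp)+
    hence cl: "c * L \<le> 1000 * (c * l) + 1 / 2" "1000 * (c * l) \<le> c * L" using c by (simp_all add: algebra_simps)
    have cL: "1 / 2 * L \<le> c * L" "c * L \<le> 4 / 5 * L" using c L by (intro mult_right_mono; simp)+
    \<comment> \<open>Writing \<open>p\<close> for \<open>c * l\<close> and \<open>q\<close> for
      \<open>c * L\<close> makes the numerical comparison linear.\<close>
    have num_upper: "1 + 340 * l + (159 * p + (2 + 1 / 10000 * (2 + 499 * l))) + (3 + l) + (q / 2 + 1 / 10000 * L)
        \<le> 2629 / 4009 * q + 1380 / 4009 * L"
      if "1000 * l \<le> L" "L \<ge> 1000000" "1000 * p \<le> q" "q \<le> 4 / 5 * L" for l L p q :: real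
      using that by (simp add: field_simps)
    have num_lower: "2629 / 4009 * q \<le> (159 * p - (2 + 1 / 10000 * (2 + 499 * l))) + (q / 2 - 1 / 10000 * L)"
      if "1000 * l \<le> L" "L \<ge> 1000000" "q \<le> 1000 * p + 1 / 2" "1 / 2 * L \<le> q" for l L p q :: real
      using that by (simp add: field_simps)
    have "real (S x) \<le> x * (1 + 340 * l) + (c * x * (159 * l) + x * (2 + \<epsilon> * (2 + 499 * l))) + x * (3 + l) + (c * x * (L / 2) + \<epsilon> * x * L)"
      unfolding S_eq using low gap mid val by (intro add_mono) linarith+
    also have "\<dots> = x * (1 + 340 * l + (159 * (c * l) + (2 + \<epsilon> * (2 + 499 * l))) + (3 + l) + (c * L / 2 + \<epsilon> * L))"
      by (simp add: algebra_simps)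
    also have "\<dots> \<le> x * (2629 / 4009 * (c * L) + 1380 / 4009 * L)"
    proof (rule mult_left_mono)
      show "1 + 340 * l + (159 * (c * l) + (2 + \<epsilon> * (2 + 499 * l))) + (3 + l) + (c * L / 2 + \<epsilon> * L)
          \<le> 2629 / 4009 * (c * L) + 1380 / 4009 * L"
        using num_upper[of l L "c * l" "c * L"] l L cl cL by (simp add: \<epsilon>_def)
    qed (use x in simp)
    finally have upper: "real (S x) \<le> (2629 / 4009 * c + 1380 / 4009) * (x * L)"
      by (simp add: algebra_simps)
    have "(2629 / 4009 * c) * (x * L) = x * (2629 / 4009 * (c * L))" by simp
    also have "\<dots> \<le> x * ((159 * (c * l) - (2 + \<epsilon> * (2 + 499 * l))) + (c * L / 2 - \<epsilon> * L))"
    proof (rule mult_left_mono)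
      show "2629 / 4009 * (c * L) \<le> (159 * (c * l) - (2 + \<epsilon> * (2 + 499 * l))) + (c * L / 2 - \<epsilon> * L)"
        using num_lower[of l L "c * L" "c * l"] l L cl cL by (simp add: \<epsilon>_def)
    qed (use x in simp)
    \<comment> \<open>The zeros stand for the ranges below \<open>A\<close> and from
      \<open>B\<close> to \<open>Z\<close>, which are dropped from the lower bound.\<close>
    also have "\<dots> = 0 + (c * x * (159 * l) - x * (2 + \<epsilon> * (2 + 499 * l))) + 0 + (c * x * (L / 2) - \<epsilon> * x * L)"
      by (simp add: algebra_simps)
    also have "\<dots> \<le> real (S x)"
      unfolding S_eq using low gap mid val by (intro add_mono) linarith+
    finally show ?case using upper unfolding c_def L_def by simp
  qed
qed

theorem theorem2p1:
  shows "\<exists>e1 e2 :: real \<Rightarrow> real.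
    (e1 \<longlongrightarrow> 0) at_top \<and> (e2 \<longlongrightarrow> 0) at_top \<and>
    (\<forall>x\<ge>3.
      (2629 / 4009 * (1 / riemann_zeta 2) + 1380 / 4009 + e1 x) * (x * ln x) \<ge> real (S x) \<and>
      real (S x) \<ge> (2629 / 4009 * (1 / riemann_zeta 2) + e2 x) * (x * ln x))"
proof -
  define a where "a = 2629 / 4009 * (1 / riemann_zeta 2)"
  define r where "r x = real (S x) / (x * ln x)" for x
  have pos: "x * ln x > 0" if "x \<ge> 3" for x :: real using that by simp
  have ev: "\<forall>\<^sub>F x in at_top. r x \<le> a + 1380 / 4009 \<and> a \<le> r x"
    using S_bounds eventually_ge_at_top[of "3::real"]
  proof eventually_elim
    case (elim x)
    thus ?case using pos[of x] by (simp add: r_def a_def divide_le_eq le_divide_eq)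
  qed
  \<comment> \<open>The error functions are the excess and the deficit of the ratio
    \<open>r x\<close>: they make both inequalities true for every \<open>x \<ge> 3\<close> and
    vanish as soon as \<open>S_bounds\<close> applies.\<close>
  let ?e1 = "\<lambda>x. max 0 (r x - (a + 1380 / 4009))" and ?e2 = "\<lambda>x. min 0 (r x - a)"
  have "(?e1 \<longlongrightarrow> 0) at_top" using ev by (intro tendsto_eventually) (auto elim!: eventually_mono)
  moreover have "(?e2 \<longlongrightarrow> 0) at_top" using ev by (intro tendsto_eventually) (auto elim!: eventually_mono)
  moreover have "(a + 1380 / 4009 + ?e1 x) * (x * ln x) \<ge> real (S x) \<and> real (S x) \<ge> (a + ?e2 x) * (x * ln x)"
    if "x \<ge> 3" for x
  proof -
    have "real (S x) = r x * (x * ln x)" using pos[OF that] unfolding r_def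
      by (metis nonzero_eq_divide_eq less_irrefl)
    moreover have "r x * (x * ln x) \<le> (a + 1380 / 4009 + ?e1 x) * (x * ln x)"
      using pos[OF that] by (intro mult_right_mono) auto
    moreover have "(a + ?e2 x) * (x * ln x) \<le> r x * (x * ln x)"
      using pos[OF that] by (intro mult_right_mono) auto
    ultimately show ?thesis by linarith
  qed
  ultimately show ?thesis unfolding a_def by blast
qed

end
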